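(* For all $u\in\mathbb{Z}_p^\times$ and $n\in\mathbb{N}$, the power series $$E_{u,n}(X)=\exp\left(\sum_{i=0}^{n-1}\frac{\omega_{u,n-i}\big(X^{p^i}-uX^{p^{i+1}}\big)}{p^i}\right)$$ is over-convergent.
   Context: $p$ is an odd prime. For $u\in\mathbb{Z}_p^\times$, let $f_u(X)\in\mathbb{Z}_p[X]$ be a Lubin–Tate polynomial for the uniformiser $up$, i.e. $f_u(X)\equiv X^p\bmod p\mathbb{Z}_p[X]$ and $f_u(X)\equiv upX\bmod X^2\mathbb{Z}_p[X]$, and let $\{\omega_{u,i}\}_{i\ge0}$ be a coherent set of roots for $f_u$: elements of $\bar{\mathbb{Q}}_p$ with $\omega_{u,0}=0\neq\omega_{u,1}$ and $f_u(\omega_{u,i})=\omega_{u,i-1}$ for $i\ge1$. A power series with coefficients in an algebraic extension of $\mathbb{Q}_p$ is over-convergent if it converges on $\{x\in\bar{\mathbb{Q}}_p:|x|_p<1+\epsilon\}$ for some $\epsilon>0$.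
   Formalization: The roots ω_{u,i} are additionally required to satisfy |ω_{u,i}|_p < 1; this is automatic when f_u has degree p, but the claim fails without it for e.g. f_u = upX + X^p + pX^{p+1}, which has a root ω_{u,1} with |ω_{u,1}|_p = p. *)

theory Defs
  imports
    "HOL-Analysis.Abstract_Metric_Spaces"
    "HOL-Computational_Algebra.Computational_Algebra"
begin

text \<open>
  Throughout, \<open>v\<close> is a real-valued multiplicative absolute value on a field.
  \<open>rat_closure v\<close> is the topological closure of the rationals; it is the copy of
  \<open>Q_p\<close> inside the field when \<open>padic_algebraic_closure p v\<close> (below) holds.
\<close>

definition rat_closure :: "('a::field_char_0 \<Rightarrow> real) \<Rightarrow> 'a set" where
  "rat_closure v = {x. \<forall>\<epsilon>>0. \<exists>q::rat. v (x - of_rat q) < \<epsilon>}"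

definition padic_integers :: "('a::field_char_0 \<Rightarrow> real) \<Rightarrow> 'a set" where
  "padic_integers v = {x \<in> rat_closure v. v x \<le> 1}"

definition padic_units :: "('a::field_char_0 \<Rightarrow> real) \<Rightarrow> 'a set" where
  "padic_units v = {x \<in> padic_integers v. \<exists>y \<in> padic_integers v. x * y = 1}"

definition padic_integer_polys :: "('a::field_char_0 \<Rightarrow> real) \<Rightarrow> 'a poly set" where
  "padic_integer_polys v = {f. \<forall>i. coeff f i \<in> padic_integers v}"

text \<open>
  The field \<open>'a\<close> with \<open>v\<close> is an algebraic closure of \<open>Q_p\<close> with its \<open>p\<close>-adic absolute
  value. A non-archimedean absolute value with \<open>v p = 1/p\<close> restricts to the usual \<open>p\<close>-adic
  one on the rationals, so by completeness the closure of the rationals is a completion of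
  \<open>(Q, |.|_p)\<close>, that is, \<open>Q_p\<close>. Since \<open>'a\<close> is algebraically closed and algebraic over it,
  \<open>('a, v)\<close> is unique up to an isometric isomorphism.
\<close>

locale padic_algebraic_closure =
  fixes p :: nat and v :: "'a::{field_char_0, alg_closed_field} \<Rightarrow> real"
  assumes prime_p: "prime p"
    and v_nonneg: "v x \<ge> 0"
    and v_eq_0_iff: "v x = 0 \<longleftrightarrow> x = 0"
    and v_mult: "v (x * y) = v x * v y"
    and v_add_le_max: "v (x + y) \<le> max (v x) (v y)"
    and v_p: "v (of_nat p) = 1 / real p"
    and complete: "Metric_space.mcomplete (rat_closure v) (\<lambda>x y. v (x - y))"
    and algebraic:
      "\<exists>g :: 'a poly. g \<noteq> 0 \<and> (\<forall>i. coeff g i \<in> rat_closure v) \<and> poly g x = 0"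

definition lubin_tate_poly ::
    "nat \<Rightarrow> ('a::field_char_0 \<Rightarrow> real) \<Rightarrow> 'a \<Rightarrow> 'a poly \<Rightarrow> bool" where
  "lubin_tate_poly p v u f \<longleftrightarrow>
     f \<in> padic_integer_polys v \<and>
     (\<exists>g \<in> padic_integer_polys v. f - monom 1 p = smult (of_nat p) g) \<and>
     (\<exists>g \<in> padic_integer_polys v. f - monom (u * of_nat p) 1 = monom 1 2 * g)"

text \<open>
  As always in Lubin--Tate theory, the roots are taken in the maximal ideal \<open>v x < 1\<close>. For
  \<open>f\<close> of degree \<open>p\<close> this is automatic, because then the leading coefficient is a unit. It is
  not automatic for \<open>f\<close> of larger degree: \<open>u p X + X^p + p X^(p+1)\<close> also has a root
  of absolute value \<open>p\<close>.
\<close>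

definition coherent_roots ::
    "('a::field_char_0 \<Rightarrow> real) \<Rightarrow> 'a poly \<Rightarrow> (nat \<Rightarrow> 'a) \<Rightarrow> bool" where
  "coherent_roots v f \<omega> \<longleftrightarrow>
     \<omega> 0 = 0 \<and> \<omega> 1 \<noteq> 0 \<and> (\<forall>i\<ge>1. poly f (\<omega> i) = \<omega> (i - 1)) \<and> (\<forall>i. v (\<omega> i) < 1)"

definition converges_at ::
    "('a::field_char_0 \<Rightarrow> real) \<Rightarrow> 'a fps \<Rightarrow> 'a \<Rightarrow> bool" where
  "converges_at v F x \<longleftrightarrow>
     (\<exists>L. (\<lambda>N. v ((\<Sum>k<N. fps_nth F k * x ^ k) - L)) \<longlonglongrightarrow> 0)"

definition over_convergent :: "('a::field_char_0 \<Rightarrow> real) \<Rightarrow> 'a fps \<Rightarrow> bool" where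
  "over_convergent v F \<longleftrightarrow> (\<exists>\<epsilon>>0. \<forall>x. v x < 1 + \<epsilon> \<longrightarrow> converges_at v F x)"

definition E_series ::
    "nat \<Rightarrow> 'a::field_char_0 \<Rightarrow> (nat \<Rightarrow> 'a) \<Rightarrow> nat \<Rightarrow> 'a fps" where
  "E_series p u \<omega> n =
     fps_exp 1 oo
       (\<Sum>i<n. fps_const (\<omega> (n - i) / of_nat p ^ i) *
                (fps_X ^ (p ^ i) - fps_const u * fps_X ^ (p ^ (i + 1))))"

end

theory Submission
  imports Defs
begin

text \<open>
  The argument is carried out for a universal series. Over \<open>Z_p[T]\<close> put \<open>F_0 = T\<close>,
  \<open>F_(j+1) = f(F_j)\<close>, let \<open>Q = \<Sum>j. F_j X^(p^j) / p^j\<close> and \<open>G = Q - u Q(X^p)\<close>; the substitution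
  \<open>T = \<omega> n\<close> turns \<open>exp G\<close> into the series of the theorem. The substitution \<open>T \<mapsto> f(T)\<close> lifts the
  Frobenius of \<open>F_p[T]\<close> and sends \<open>G\<close> to a series \<open>H\<close> with
  \<open>H(X^p) = p G + p (u T X^p - T X)\<close>, so Dwork's lemma makes \<open>exp G\<close> integral. Moreover
  \<open>f = u p T + T^2 g\<close> forces the coefficients of \<open>F_j\<close> to be \<open>O(p^(-j))\<close>, and then those of
  \<open>F_(j+1) - u p F_j = F_j^2 g(F_j)\<close> to be \<open>O(p^(-2j))\<close>; hence for each \<open>m\<close> the coefficient of
  \<open>T^m X^k\<close> in \<open>exp G\<close> tends to \<open>0\<close> as \<open>k\<close> grows. Together with integrality this shows that
  \<open>exp G\<close> at \<open>T = \<omega> n\<close> converges on the closed unit disc. There \<open>G\<close> is a polynomial in \<open>X\<close>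
  because \<open>\<omega> 0 = 0\<close>, and the exponential of a polynomial is over-convergent as soon as it
  converges on the closed unit disc and its non-constant coefficients lie in the maximal ideal.
\<close>

section \<open>Dwork's integrality lemma\<close>

text \<open>Dwork's lemma needs a ring endomorphism lifting the p-th power map. The ring generated
  over Z_p by the roots is ramified and offers no evident one, whereas T \<mapsto> f(T) is such a
  lift on Z_p[T] precisely because f \<equiv> T^p mod p. This is why T replaces the root until the
  end. Integrality alone controls only the open unit disc, and the decay that is needed on the
  closed disc is available only for each power of T separately. The two facts complement each other:
  as \<open>v (\<omega> n) < 1\<close>, high powers of T are harmless once the coefficients are
  integral. For odd p the number 1/p lies strictly below p^(-1/(p-1)), the radius of convergence of
  exp. A series congruent to 1 modulo p then has a logarithm with room to spare, and this room pays
  for enlarging the disc. Bounds on coefficients do not yet give a limit in the field, since an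
  algebraic closure of Q_p is not complete; the limit is found in a finite-dimensional subspace over
  \<open>rat_closure v\<close>.\<close>

definition subring_set :: "'b::comm_ring_1 set \<Rightarrow> bool" where
  "subring_set S \<longleftrightarrow> 1 \<in> S \<and> (\<forall>x\<in>S. \<forall>y\<in>S. x - y \<in> S \<and> x * y \<in> S)"

lemma subring_set_1: "subring_set S \<Longrightarrow> 1 \<in> S"
  and subring_set_diff: "subring_set S \<Longrightarrow> x \<in> S \<Longrightarrow> y \<in> S \<Longrightarrow> x - y \<in> S"
  and subring_set_mult: "subring_set S \<Longrightarrow> x \<in> S \<Longrightarrow> y \<in> S \<Longrightarrow> x * y \<in> S"
  by (auto simp: subring_set_def)

lemma subring_set_0: "subring_set S \<Longrightarrow> 0 \<in> S"
  using subring_set_1 subring_set_diff by fastforce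

lemma subring_set_uminus: "subring_set S \<Longrightarrow> x \<in> S \<Longrightarrow> - x \<in> S"
  using subring_set_diff[of S 0 x] subring_set_0 by auto

lemma subring_set_add: "subring_set S \<Longrightarrow> x \<in> S \<Longrightarrow> y \<in> S \<Longrightarrow> x + y \<in> S"
  using subring_set_diff[of S x "- y"] subring_set_uminus by auto

lemma subring_set_power: "subring_set S \<Longrightarrow> x \<in> S \<Longrightarrow> x ^ n \<in> S"
  by (induction n) (auto intro: subring_set_1 subring_set_mult)

lemma subring_set_sum:
  "subring_set S \<Longrightarrow> (\<And>i. i \<in> I \<Longrightarrow> g i \<in> S) \<Longrightarrow> sum g I \<in> S"
  by (induction I rule: infinite_finite_induct) (auto intro: subring_set_0 subring_set_add)

lemma subring_set_of_nat: "subring_set S \<Longrightarrow> of_nat n \<in> S"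
  by (induction n) (auto intro: subring_set_0 subring_set_1 subring_set_add)

lemmas subring_set_intros = subring_set_0 subring_set_1 subring_set_diff subring_set_mult
  subring_set_uminus subring_set_add subring_set_power subring_set_sum subring_set_of_nat

definition poly_set :: "'b::comm_ring_1 set \<Rightarrow> 'b poly set" where
  "poly_set S = {q. \<forall>i. coeff q i \<in> S}"

definition fps_set :: "'b::comm_ring_1 set \<Rightarrow> 'b fps set" where
  "fps_set S = {F. \<forall>i. fps_nth F i \<in> S}"

lemma subring_set_poly_set: "subring_set S \<Longrightarrow> subring_set (poly_set S)"
  unfolding subring_set_def[of "poly_set S"]
  by (auto simp: poly_set_def coeff_mult lead_coeff_1 if_distrib coeff_1 intro!: subring_set_intros)

lemma subring_set_fps_set: "subring_set S \<Longrightarrow> subring_set (fps_set S)"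
  unfolding subring_set_def[of "fps_set S"]
  by (auto simp: fps_set_def fps_mult_nth intro!: subring_set_intros)

text \<open>The quotient must lie in \<open>S\<close>: in a field containing Z_p every element is a
  multiple of p, so divisibility in the ambient type would say nothing.\<close>

definition cong_set :: "'b::comm_ring_1 set \<Rightarrow> 'b \<Rightarrow> 'b \<Rightarrow> 'b \<Rightarrow> bool" where
  "cong_set S m x y \<longleftrightarrow> (\<exists>s\<in>S. x - y = m * s)"

lemma cong_set_refl: "subring_set S \<Longrightarrow> cong_set S m x x"
  by (auto simp: cong_set_def intro!: bexI[of _ 0] subring_set_0)

lemma cong_set_sym: "subring_set S \<Longrightarrow> cong_set S m x y \<Longrightarrow> cong_set S m y x"
  unfolding cong_set_def
  by (metis minus_diff_eq mult_minus_right subring_set_uminus)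

lemma cong_set_trans:
  assumes "subring_set S" "cong_set S m x y" "cong_set S m y z"
  shows "cong_set S m x z"
proof -
  obtain s t where "s \<in> S" "t \<in> S" "x - y = m * s" "y - z = m * t"
    using assms by (auto simp: cong_set_def)
  then have "x - z = m * (s + t)" by (simp add: algebra_simps)
  then show ?thesis
    using \<open>s \<in> S\<close> \<open>t \<in> S\<close> assms(1) by (auto simp: cong_set_def intro!: subring_set_add)
qed

lemma cong_set_add:
  assumes "subring_set S" "cong_set S m x y" "cong_set S m x' y'"
  shows "cong_set S m (x + x') (y + y')"
proof -
  obtain s t where "s \<in> S" "t \<in> S" "x - y = m * s" "x' - y' = m * t"
    using assms by (auto simp: cong_set_def)
  then have "(x + x') - (y + y') = m * (s + t)" by (simp add: algebra_simps)
  then show ?thesis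
    using \<open>s \<in> S\<close> \<open>t \<in> S\<close> assms(1) by (auto simp: cong_set_def intro!: subring_set_add)
qed

lemma cong_set_mult:
  assumes "subring_set S" "cong_set S m x y" "cong_set S m x' y'" "x \<in> S" "y' \<in> S"
  shows "cong_set S m (x * x') (y * y')"
proof -
  obtain s t where st: "s \<in> S" "t \<in> S" "x - y = m * s" "x' - y' = m * t"
    using assms by (auto simp: cong_set_def)
  have "x * x' - y * y' = x * (x' - y') + (x - y) * y'" by (simp add: algebra_simps)
  also have "\<dots> = m * (x * t + s * y')"
    unfolding st by (simp add: algebra_simps)
  finally show ?thesis
    using st assms by (auto simp: cong_set_def intro!: subring_set_intros)
qed

lemma cong_set_sum:
  assumes "subring_set S" "\<And>i. i \<in> I \<Longrightarrow> cong_set S m (g i) (h i)"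
  shows "cong_set S m (sum g I) (sum h I)"
  using assms(2)
  by (induction I rule: infinite_finite_induct)
     (auto intro: cong_set_refl cong_set_add assms(1))

lemma freshman_add:
  assumes S: "subring_set S" and p: "prime p" and xy: "x \<in> S" "y \<in> S"
  shows "cong_set S (of_nat p) ((x + y) ^ p) (x ^ p + y ^ p)"
proof -
  have p0: "p > 0" using p prime_gt_0_nat by blast
  define g where "g k = of_nat (p choose k) * x ^ k * y ^ (p - k)" for k
  have "{..p} = insert 0 (insert p {1..<p})" using p0 by auto
  then have "(x + y) ^ p = g 0 + (g p + sum g {1..<p})"
    using p0 unfolding binomial_ring g_def by simp
  then have "(x + y) ^ p = x ^ p + y ^ p + sum g {1..<p}"
    by (simp add: g_def algebra_simps)
  moreover have "sum g {1..<p} =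
      of_nat p * (\<Sum>k\<in>{1..<p}. of_nat ((p choose k) div p) * x ^ k * y ^ (p - k))"
    unfolding sum_distrib_left
  proof (intro sum.cong refl)
    fix k assume "k \<in> {1..<p}"
    then have "p dvd p choose k" using p by (intro dvd_choose_prime) auto
    then have "p choose k = p * ((p choose k) div p)" by simp
    then have "(of_nat (p choose k) :: 'a) = of_nat p * of_nat ((p choose k) div p)"
      by (metis of_nat_mult)
    then show "g k = of_nat p * (of_nat ((p choose k) div p) * x ^ k * y ^ (p - k))"
      by (simp add: g_def mult_ac)
  qed
  ultimately show ?thesis
    using S xy by (auto simp: cong_set_def intro!: subring_set_intros bexI)
qed

lemma freshman_sum:
  assumes S: "subring_set S" and p: "prime p" and "\<And>i. i \<in> I \<Longrightarrow> g i \<in> S"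
  shows "cong_set S (of_nat p) ((sum g I) ^ p) (\<Sum>i\<in>I. g i ^ p)"
  using assms(3)
proof (induction I rule: infinite_finite_induct)
  case (insert i I)
  have "cong_set S (of_nat p) ((g i + sum g I) ^ p) (g i ^ p + sum g I ^ p)"
    using insert by (intro freshman_add S p subring_set_sum) auto
  moreover have "cong_set S (of_nat p) (g i ^ p + sum g I ^ p) (g i ^ p + (\<Sum>i\<in>I. g i ^ p))"
    using insert by (intro cong_set_add cong_set_refl S) auto
  ultimately show ?case
    using insert.hyps S by (auto intro: cong_set_trans)
qed (use p prime_gt_0_nat in \<open>auto intro!: cong_set_refl S simp: zero_power\<close>)

text \<open>Modulo p both \<open>pcompose q f\<close> and \<open>q ^ p\<close> are additive and
  multiplicative in q. They agree on constants by the Fermat hypothesis and at T because f \<equiv>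
  T^p. The induction is Horner's scheme q = a + T q'.\<close>

lemma pcompose_frobenius:
  assumes S: "subring_set S" and p: "prime p"
    and fermat: "\<And>a. a \<in> S \<Longrightarrow> cong_set S (of_nat p) (a ^ p) a"
    and f: "f \<in> poly_set S" "cong_set (poly_set S) (of_nat p) f (monom 1 p)"
    and "q \<in> poly_set S"
  shows "cong_set (poly_set S) (of_nat p) (pcompose q f) (q ^ p)"
  using assms(6)
proof (induction q)
  case 0
  then show ?case
    using p prime_gt_0_nat by (auto intro!: cong_set_refl subring_set_poly_set S simp: zero_power)
next
  case (pCons a q)
  have S': "subring_set (poly_set S)" using S by (rule subring_set_poly_set)
  have a: "a \<in> S" and q: "q \<in> poly_set S"
    using pCons.prems unfolding poly_set_def
    by (auto simp: coeff_pCons split: nat.splits dest: spec[of _ 0] spec[of _ "Suc _"])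
  have aS: "[:a:] \<in> poly_set S" using a S
    by (auto simp: poly_set_def coeff_pCons split: nat.splits intro: subring_set_0)
  have XS: "monom 1 n \<in> poly_set S" for n
    using S by (auto simp: poly_set_def intro: subring_set_intros)
  have pCons_eq: "pCons a q = [:a:] + monom 1 1 * q"
    by (simp add: monom_altdef)
  have "cong_set (poly_set S) (of_nat p) ((pCons a q) ^ p) ([:a:] ^ p + (monom 1 1 * q) ^ p)"
    unfolding pCons_eq by (intro freshman_add S' p aS subring_set_mult XS q)
  moreover have "cong_set (poly_set S) (of_nat p) ([:a:] ^ p + (monom 1 1 * q) ^ p)
      ([:a:] + f * pcompose q f)"
  proof (intro cong_set_add S')
    obtain s where s: "s \<in> S" "a ^ p - a = of_nat p * s"
      using fermat[OF a] by (auto simp: cong_set_def)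
    have "[:a:] ^ p - [:a:] = of_nat p * [:s:]"
      by (simp add: poly_const_pow s of_nat_poly)
    moreover have "[:s:] \<in> poly_set S" using s S
      by (auto simp: poly_set_def coeff_pCons split: nat.splits intro: subring_set_0)
    ultimately show "cong_set (poly_set S) (of_nat p) ([:a:] ^ p) [:a:]"
      unfolding cong_set_def by blast
    have "cong_set (poly_set S) (of_nat p) (monom 1 p * q ^ p) (f * pcompose q f)"
    proof (rule cong_set_mult[OF S'])
      show "cong_set (poly_set S) (of_nat p) (monom 1 p) f"
        using f(2) by (rule cong_set_sym[OF S'])
      show "cong_set (poly_set S) (of_nat p) (q ^ p) (pcompose q f)"
        using pCons.IH[OF q] by (rule cong_set_sym[OF S'])
      show "monom 1 p \<in> poly_set S" by (rule XS)
      show "pcompose q f \<in> poly_set S"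
      proof -
        obtain s where s: "s \<in> poly_set S" "pcompose q f - q ^ p = of_nat p * s"
          using pCons.IH[OF q] by (auto simp: cong_set_def)
        then have "pcompose q f = q ^ p + of_nat p * s"
          by (simp add: algebra_simps)
        then show ?thesis
          using s(1) q by (auto intro!: subring_set_add subring_set_mult subring_set_power
              subring_set_of_nat S')
      qed
    qed
    then show "cong_set (poly_set S) (of_nat p) ((monom 1 1 * q) ^ p) (f * pcompose q f)"
      by (simp add: power_mult_distrib monom_power)
  qed
  ultimately have "cong_set (poly_set S) (of_nat p) ((pCons a q) ^ p) ([:a:] + f * pcompose q f)"
    using S' by (blast intro: cong_set_trans)
  then show ?case
    using S' by (simp add: pcompose_pCons cong_set_sym)
qed

text \<open>The Frobenius lift F(X) \<mapsto> (\<phi> F)(X^p) on power series, with \<phi> acting on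
  coefficients. The coefficientwise form shows that coefficient k depends only on coefficient k div
  p, which is what Dwork's recursion uses.\<close>

definition fps_twist :: "('b::comm_ring_1 \<Rightarrow> 'b) \<Rightarrow> nat \<Rightarrow> 'b fps \<Rightarrow> 'b fps" where
  "fps_twist \<phi> p F = Abs_fps (\<lambda>k. if p dvd k then \<phi> (fps_nth F (k div p)) else 0)"

text \<open>For a polynomial the p-th power is additive modulo p, and (c X^i)^p \<equiv> \<phi>(c)
  X^(ip). The cut at \<open>k\<close> keeps the sum finite and asks for integrality only of the
  coefficients that the recursion has reached.\<close>

lemma fps_twist_cong_power:
  assumes S: "subring_set S" and p: "prime p" and \<phi>0: "\<phi> 0 = 0"
    and \<phi>: "\<And>s. s \<in> S \<Longrightarrow> cong_set S (of_nat p) (\<phi> s) (s ^ p)"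
    and c: "\<And>i. i < k \<Longrightarrow> c i \<in> S"
    and P: "P = Abs_fps (\<lambda>i. if i < k then c i else 0)"
  shows "cong_set (fps_set S) (of_nat p) (fps_twist \<phi> p P) (P ^ p)"
proof -
  have S': "subring_set (fps_set S)" using S by (rule subring_set_fps_set)
  have p0: "p > 0" using p prime_gt_0_nat by blast
  have const: "fps_const a \<in> fps_set S" if "a \<in> S" for a
    using that S by (auto simp: fps_set_def intro: subring_set_0)
  have X: "fps_X ^ i \<in> fps_set S" for i
    using S by (auto simp: fps_set_def fps_X_power_nth intro: subring_set_intros)
  have "P = (\<Sum>i<k. fps_const (c i) * fps_X ^ i)"
    by (rule fps_ext) (simp add: P fps_sum_nth fps_X_power_nth if_distrib sum.delta' cong: if_cong)
  then have "cong_set (fps_set S) (of_nat p) (P ^ p) (\<Sum>i<k. (fps_const (c i) * fps_X ^ i) ^ p)"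
    using c by (auto intro!: freshman_sum S' p subring_set_mult const X)
  moreover have "cong_set (fps_set S) (of_nat p) (\<Sum>i<k. (fps_const (c i) * fps_X ^ i) ^ p)
     (\<Sum>i<k. fps_const (\<phi> (c i)) * (fps_X ^ i) ^ p)"
    unfolding power_mult_distrib
  proof (intro cong_set_sum S' cong_set_mult cong_set_refl subring_set_power[OF S'] const X)
    fix i assume i: "i \<in> {..<k}"
    then show "c i \<in> S" using c by auto
    then obtain s where "s \<in> S" "\<phi> (c i) - c i ^ p = of_nat p * s"
      using \<phi> by (auto simp: cong_set_def)
    then have "fps_const (\<phi> (c i)) - fps_const (c i) ^ p = of_nat p * fps_const s"
      by (simp add: fps_const_power flip: fps_of_nat)
    then show "cong_set (fps_set S) (of_nat p) (fps_const (c i) ^ p) (fps_const (\<phi> (c i)))"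
      using const[OF \<open>s \<in> S\<close>] by - (rule cong_set_sym[OF S'], auto simp: cong_set_def)
  qed (use X[of 1] in simp)
  moreover have "(\<Sum>i<k. fps_const (\<phi> (c i)) * (fps_X ^ i) ^ p) = fps_twist \<phi> p P"
  proof (rule fps_ext)
    fix m
    have "fps_nth (\<Sum>i<k. fps_const (\<phi> (c i)) * (fps_X ^ i) ^ p) m =
       (\<Sum>i<k. if i * p = m then \<phi> (c i) else 0)"
      by (simp add: fps_sum_nth fps_X_power_nth if_distrib eq_commute flip: power_mult cong: if_cong)
    also have "\<dots> = (if p dvd m then (\<Sum>i<k. if i = m div p then \<phi> (c i) else 0) else 0)"
      using p0 by (auto intro!: sum.cong sum.neutral)
    also have "\<dots> = fps_nth (fps_twist \<phi> p P) m"
      by (auto simp: fps_twist_def P \<phi>0)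
    finally show "fps_nth (\<Sum>i<k. fps_const (\<phi> (c i)) * (fps_X ^ i) ^ p) m =
      fps_nth (fps_twist \<phi> p P) m" .
  qed
  ultimately show ?thesis
    using S' by (metis cong_set_sym cong_set_trans)
qed

text \<open>Coefficient k of both sides of \<open>eq\<close> is compared. On the left only
  coefficient k div p of F enters; on the right F_k enters as p F_k. The truncation P below k makes
  the left side agree with P^p modulo p, so p F_k is p times an element of \<open>S\<close>, and p
  cancels in characteristic zero.\<close>

lemma dwork_integrality:
  fixes F V :: "'b::{idom,ring_char_0} fps"
  assumes S: "subring_set S" and p: "prime p" and \<phi>0: "\<phi> 0 = 0"
    and \<phi>: "\<And>s. s \<in> S \<Longrightarrow> cong_set S (of_nat p) (\<phi> s) (s ^ p)"
    and F0: "fps_nth F 0 = 1" and V: "V \<in> fps_set S" "fps_nth V 0 = 0"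
    and eq: "fps_twist \<phi> p F = F ^ p * (1 + of_nat p * V)"
  shows "F \<in> fps_set S"
proof -
  have "fps_nth F k \<in> S" for k
  proof (induction k rule: less_induct)
    case (less k)
    show ?case
    proof (cases "k = 0")
      case True
      then show ?thesis using F0 S by (simp add: subring_set_1)
    next
      case False
      have S': "subring_set (fps_set S)" using S by (rule subring_set_fps_set)
      have p1: "p > 1" using p prime_gt_1_nat by blast
      define P where "P = Abs_fps (\<lambda>i. if i < k then fps_nth F i else 0)"
      define R where "R = fps_shift k F"
      have P: "P \<in> fps_set S"
        using less S by (auto simp: fps_set_def P_def intro: subring_set_0)
      have FPR: "F = P + fps_X ^ k * R"
        by (rule fps_ext) (auto simp: P_def R_def fps_X_power_mult_nth)
      \<comment> \<open>In (P + X^k R)^n the factor in front of X^k starts with n P^(n-1) R, whose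
        value at X = 0 is n F_k because F_0 = 1 and k > 0.\<close>
      have pow: "\<exists>Q. F ^ n = P ^ n + fps_X ^ k * Q \<and> fps_nth Q 0 = of_nat n * fps_nth F k" for n
      proof (induction n)
        case 0
        then show ?case by (intro exI[of _ 0]) auto
      next
        case (Suc n)
        then obtain Q where Q: "F ^ n = P ^ n + fps_X ^ k * Q"
            "fps_nth Q 0 = of_nat n * fps_nth F k" by blast
        have "F ^ Suc n = (P + fps_X ^ k * R) * (P ^ n + fps_X ^ k * Q)"
          using Q FPR by simp
        also have "\<dots> = P ^ Suc n + fps_X ^ k * (P * Q + R * P ^ n + fps_X ^ k * R * Q)"
          by (simp add: algebra_simps)
        finally show ?case
          using False Q F0
          by (intro exI[of _ "P * Q + R * P ^ n + fps_X ^ k * R * Q"])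
             (auto simp: P_def R_def algebra_simps fps_power_zeroth)
      qed
      obtain Q where Q: "F ^ p = P ^ p + fps_X ^ k * Q" "fps_nth Q 0 = of_nat p * fps_nth F k"
        using pow by blast
      have "fps_nth (fps_twist \<phi> p F) k = fps_nth (fps_twist \<phi> p P) k"
        using False p1 by (auto simp: fps_twist_def P_def)
      moreover have "F ^ p * (1 + of_nat p * V) =
          P ^ p + of_nat p * (P ^ p * V) + fps_X ^ k * (Q * (1 + of_nat p * V))"
        unfolding Q(1) by (simp add: algebra_simps)
      moreover have "fps_nth (fps_X ^ k * (Q * (1 + of_nat p * V))) k = of_nat p * fps_nth F k"
        using Q(2) V(2) by (simp add: fps_X_power_mult_nth)
      moreover have ofp: "fps_nth (of_nat p * H) k = of_nat p * fps_nth H k" for H :: "'b fps"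
        by (metis fps_mult_left_const_nth fps_of_nat)
      ultimately have e1: "fps_nth (fps_twist \<phi> p P) k =
          fps_nth (P ^ p) k + of_nat p * fps_nth (P ^ p * V) k + of_nat p * fps_nth F k"
        unfolding eq by simp
      have "cong_set (fps_set S) (of_nat p) (fps_twist \<phi> p P) (P ^ p)"
        using less by (intro fps_twist_cong_power[OF S p \<phi>0 \<phi> _ P_def]) auto
      then obtain H where H: "H \<in> fps_set S" "fps_twist \<phi> p P - P ^ p = of_nat p * H"
        by (auto simp: cong_set_def)
      then have "fps_nth (fps_twist \<phi> p P) k - fps_nth (P ^ p) k = of_nat p * fps_nth H k"
        using ofp by (metis fps_sub_nth)
      with e1 have "of_nat p * fps_nth F k = of_nat p * (fps_nth H k - fps_nth (P ^ p * V) k)"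
        by (simp add: algebra_simps)
      then have "fps_nth F k = fps_nth H k - fps_nth (P ^ p * V) k"
        using p1 by simp
      moreover have "H - P ^ p * V \<in> fps_set S"
        using H P V by (intro subring_set_intros S')
      ultimately show ?thesis
        by (auto simp: fps_set_def)
    qed
  qed
  then show ?thesis by (simp add: fps_set_def)
qed

section \<open>Ring homomorphisms on power series and the formal exponential\<close>

definition is_ring_hom :: "('b::comm_ring_1 \<Rightarrow> 'c::comm_ring_1) \<Rightarrow> bool" where
  "is_ring_hom \<psi> \<longleftrightarrow> \<psi> 1 = 1 \<and> (\<forall>x y. \<psi> (x + y) = \<psi> x + \<psi> y \<and> \<psi> (x * y) = \<psi> x * \<psi> y)"

lemma is_ring_hom_simps:
  assumes "is_ring_hom \<psi>"
  shows "\<psi> 1 = 1" "\<psi> (x + y) = \<psi> x + \<psi> y" "\<psi> (x * y) = \<psi> x * \<psi> y" "\<psi> 0 = 0"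
proof -
  show *: "\<psi> 1 = 1" "\<psi> (x + y) = \<psi> x + \<psi> y" "\<psi> (x * y) = \<psi> x * \<psi> y" for x y
    using assms by (auto simp: is_ring_hom_def)
  show "\<psi> 0 = 0" using *(2)[of 0 0] by simp
qed

lemma is_ring_hom_sum: "is_ring_hom \<psi> \<Longrightarrow> \<psi> (sum g I) = (\<Sum>i\<in>I. \<psi> (g i))"
  by (induction I rule: infinite_finite_induct) (auto simp: is_ring_hom_simps)

lemma is_ring_hom_of_nat: "is_ring_hom \<psi> \<Longrightarrow> \<psi> (of_nat n) = of_nat n"
  by (induction n) (auto simp: is_ring_hom_simps)

definition map_fps :: "('b::comm_ring_1 \<Rightarrow> 'c::comm_ring_1) \<Rightarrow> 'b fps \<Rightarrow> 'c fps" where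
  "map_fps \<psi> F = Abs_fps (\<lambda>k. \<psi> (fps_nth F k))"

lemma map_fps_nth [simp]: "fps_nth (map_fps \<psi> F) k = \<psi> (fps_nth F k)"
  by (simp add: map_fps_def)

lemma is_ring_hom_map_fps: "is_ring_hom \<psi> \<Longrightarrow> is_ring_hom (map_fps \<psi>)"
  unfolding is_ring_hom_def[of "map_fps \<psi>"]
  by (auto simp: fps_eq_iff is_ring_hom_simps is_ring_hom_sum fps_mult_nth)

lemma map_fps_power: "is_ring_hom \<psi> \<Longrightarrow> map_fps \<psi> (F ^ n) = map_fps \<psi> F ^ n"
  by (induction n) (auto simp: is_ring_hom_simps is_ring_hom_map_fps)

lemma map_fps_compose:
  "is_ring_hom \<psi> \<Longrightarrow> map_fps \<psi> (A oo B) = map_fps \<psi> A oo map_fps \<psi> B"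
  by (auto simp: fps_eq_iff fps_compose_nth is_ring_hom_simps is_ring_hom_sum
        simp flip: map_fps_power)

lemma fps_twist_conv_compose:
  fixes F :: "'b::idom fps"
  assumes "p > 0"
  shows "fps_twist \<phi> p F = map_fps \<phi> F oo fps_X ^ p"
  using assms by (auto simp: fps_eq_iff fps_twist_def fps_nth_compose_X_power)

text \<open>The coefficients will be polynomials in T, which do not form a field, so exp is pinned
  down by i! e_i = 1 without division. The equation survives every ring homomorphism.\<close>

definition is_exp_fps :: "'b::{idom,ring_char_0} fps \<Rightarrow> bool" where
  "is_exp_fps E \<longleftrightarrow> (\<forall>i. fact i * fps_nth E i = 1)"

lemma is_exp_fps_0: "is_exp_fps E \<Longrightarrow> fps_nth E 0 = 1"
  unfolding is_exp_fps_def by (metis fact_0 mult_1)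

lemma is_exp_fps_unique:
  assumes "is_exp_fps E" "is_exp_fps E'"
  shows "E = E'"
proof (rule fps_ext)
  fix i
  have "fact i * fps_nth E i = fact i * fps_nth E' i"
    using assms by (simp add: is_exp_fps_def)
  then show "fps_nth E i = fps_nth E' i" by simp
qed

lemma is_exp_fps_map:
  assumes "is_ring_hom \<psi>" "is_exp_fps E"
  shows "is_exp_fps (map_fps \<psi> E)"
  unfolding is_exp_fps_def
proof
  fix i
  have "\<psi> (fact i) = fact i"
    using is_ring_hom_of_nat[OF assms(1), of "fact i"] by simp
  moreover have "fact i * fps_nth E i = 1"
    using assms(2) by (simp add: is_exp_fps_def)
  then have "\<psi> (fact i * fps_nth E i) = 1"
    by (simp only: is_ring_hom_simps(1)[OF assms(1)])
  ultimately show "fact i * fps_nth (map_fps \<psi> E) i = 1"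
    by (simp only: is_ring_hom_simps(3)[OF assms(1)] map_fps_nth)
qed

lemma is_exp_fps_deriv:
  assumes "is_exp_fps E"
  shows "fps_deriv E = E"
proof (rule fps_ext)
  fix i
  have "fact i * (of_nat (Suc i) * fps_nth E (Suc i)) = fact (Suc i) * fps_nth E (Suc i)"
    by (simp add: algebra_simps)
  also have "\<dots> = fact i * fps_nth E i"
    using assms by (simp only: is_exp_fps_def)
  finally show "fps_nth (fps_deriv E) i = fps_nth E i"
    by simp
qed

text \<open>Y' = Y D determines coefficient m + 1 from the lower ones. This yields the functional
  equation of exp and later identifies a series with the exponential of its logarithm.\<close>

lemma fps_linear_ode_unique:
  fixes F H D :: "'b::{idom,ring_char_0} fps"
  assumes F: "fps_deriv F = F * D" and H: "fps_deriv H = H * D" and 0: "fps_nth F 0 = fps_nth H 0"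
  shows "F = H"
proof (rule fps_ext)
  fix k
  show "fps_nth F k = fps_nth H k"
  proof (induction k rule: less_induct)
    case (less k)
    show ?case
    proof (cases k)
      case 0
      then show ?thesis using \<open>fps_nth F 0 = fps_nth H 0\<close> by simp
    next
      case (Suc m)
      have "fps_nth (F * D) m = fps_nth (H * D) m"
        using less Suc unfolding fps_mult_nth by (intro sum.cong) auto
      then have "fps_nth (fps_deriv F) m = fps_nth (fps_deriv H) m"
        using F H by simp
      then have "of_nat (Suc m) * fps_nth F k = of_nat (Suc m) * fps_nth H k"
        using Suc by simp
      then show ?thesis by (simp del: of_nat_Suc)
    qed
  qed
qed

lemma exp_compose_deriv:
  assumes "is_exp_fps E" "fps_nth G 0 = 0"
  shows "fps_deriv (E oo G) = (E oo G) * fps_deriv G"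
  using assms by (simp add: fps_compose_deriv is_exp_fps_deriv)

lemma exp_compose_add:
  assumes "is_exp_fps E" "fps_nth G 0 = 0" "fps_nth H 0 = 0"
  shows "E oo (G + H) = (E oo G) * (E oo H)"
  by (rule fps_linear_ode_unique[where D = "fps_deriv (G + H)"])
     (use assms in \<open>simp_all add: exp_compose_deriv is_exp_fps_0 algebra_simps\<close>)

lemma exp_compose_of_nat_mult:
  assumes "is_exp_fps E" "fps_nth G 0 = 0"
  shows "E oo (of_nat n * G) = (E oo G) ^ n"
proof (induction n)
  case 0
  then show ?case using assms by (simp add: is_exp_fps_0)
next
  case (Suc n)
  have "E oo (of_nat (Suc n) * G) = E oo (G + of_nat n * G)"
    by (simp add: algebra_simps)
  also have "\<dots> = (E oo G) * (E oo (of_nat n * G))"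
    using assms by (intro exp_compose_add) auto
  finally show ?case using Suc by simp
qed

lemma fps_compose_in_fps_set:
  "subring_set S \<Longrightarrow> A \<in> fps_set S \<Longrightarrow> B \<in> fps_set S \<Longrightarrow> A oo B \<in> fps_set S"
  using subring_set_power[OF subring_set_fps_set, of S B]
  by (auto simp: fps_set_def fps_compose_nth intro!: subring_set_sum subring_set_mult)

text \<open>exp(pW) - 1 is p times the sum of p^(i-1)/i! W^i over i > 0. The numbers p^(i-1)/i! are
  handed over as \<open>e\<close>, since their membership in \<open>S\<close> is arithmetic that
  depends on p.\<close>

lemma exp_compose_prime_mult:
  assumes S: "subring_set S" and E: "is_exp_fps E"
    and e: "\<And>i. i > 0 \<Longrightarrow> fps_nth e i \<in> S \<and> fact i * fps_nth e i = of_nat p ^ (i - 1)"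
    and e0: "fps_nth e 0 = 0" and W: "W \<in> fps_set S"
  obtains V where "V \<in> fps_set S" "fps_nth V 0 = 0" "E oo (of_nat p * W) = 1 + of_nat p * V"
proof
  show "e oo W \<in> fps_set S"
  proof (intro fps_compose_in_fps_set S W)
    have "fps_nth e i \<in> S" for i
      using e[of i] e0 subring_set_0[OF S] by (cases "i = 0") auto
    then show "e \<in> fps_set S" by (simp add: fps_set_def)
  qed
  show "fps_nth (e oo W) 0 = 0" using e0 by simp
  have Ei: "fps_nth E i * of_nat p ^ i = (if i = 0 then 1 else 0) + of_nat p * fps_nth e i" for i
  proof (cases "i = 0")
    case False
    then have "fact i * (of_nat p * fps_nth e i) = of_nat p ^ i"
      using e[of i] by (simp add: mult.left_commute power_eq_if)
    moreover have "fact i * (fps_nth E i * of_nat p ^ i) = of_nat p ^ i"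
      using E by (simp add: is_exp_fps_def flip: mult.assoc)
    ultimately have "fact i * (fps_nth E i * of_nat p ^ i) = fact i * (of_nat p * fps_nth e i)"
      by simp
    then show ?thesis using False by simp
  qed (use E e0 in \<open>simp add: is_exp_fps_0\<close>)
  have ofp: "fps_nth (of_nat m * H) k = of_nat m * fps_nth H k" for m k and H :: "'a fps"
    by (metis fps_mult_left_const_nth fps_of_nat)
  show "E oo (of_nat p * W) = 1 + of_nat p * (e oo W)"
  proof (rule fps_ext)
    fix k
    have "fps_nth (E oo (of_nat p * W)) k =
        (\<Sum>i=0..k. (fps_nth E i * of_nat p ^ i) * fps_nth (W ^ i) k)"
      unfolding fps_compose_nth power_mult_distrib of_nat_power[symmetric] ofp
      by (simp add: mult_ac)
    also have "\<dots> = (\<Sum>i=0..k. (if i = 0 then fps_nth (1 :: 'a fps) k else 0) +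
        of_nat p * (fps_nth e i * fps_nth (W ^ i) k))"
      unfolding Ei by (intro sum.cong refl) (simp add: algebra_simps)
    also have "\<dots> = fps_nth (1 :: 'a fps) k +
        of_nat p * (\<Sum>i=0..k. fps_nth e i * fps_nth (W ^ i) k)"
      unfolding sum.distrib sum_distrib_left by simp
    also have "\<dots> = fps_nth (1 + of_nat p * (e oo W)) k"
      by (simp add: fps_compose_nth ofp)
    finally show "fps_nth (E oo (of_nat p * W)) k = fps_nth (1 + of_nat p * (e oo W)) k" .
  qed
qed

lemma is_ring_hom_pcompose: "is_ring_hom (\<lambda>q. pcompose q f)"
  by (simp add: is_ring_hom_def pcompose_1 pcompose_add pcompose_mult)

lemma is_ring_hom_poly: "is_ring_hom (\<lambda>q. poly q x)"
  by (simp add: is_ring_hom_def)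

lemma padic_integer_polys_eq: "padic_integer_polys v = poly_set (padic_integers v)"
  by (simp add: padic_integer_polys_def poly_set_def)

lemma of_rat_fact: "of_rat (fact i) = (fact i :: 'a::field_char_0)"
  by (metis of_nat_fact of_rat_of_nat_eq)

lemma map_fps_X_power: "is_ring_hom \<psi> \<Longrightarrow> map_fps \<psi> (fps_X ^ n) = fps_X ^ n"
  by (rule fps_ext) (simp add: fps_X_power_nth is_ring_hom_simps)

lemma map_fps_const: "is_ring_hom \<psi> \<Longrightarrow> map_fps \<psi> (fps_const c) = fps_const (\<psi> c)"
  by (rule fps_ext) (simp add: is_ring_hom_simps)

lemma map_fps_diff: "is_ring_hom \<psi> \<Longrightarrow> map_fps \<psi> (F - G) = map_fps \<psi> F - map_fps \<psi> G"
  by (metis add_diff_cancel_right' diff_add_cancel is_ring_hom_map_fps is_ring_hom_simps(2))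

lemma map_fps_mult: "is_ring_hom \<psi> \<Longrightarrow> map_fps \<psi> (F * G) = map_fps \<psi> F * map_fps \<psi> G"
  by (simp add: is_ring_hom_map_fps is_ring_hom_simps)

lemma pcompose_in_poly_set:
  assumes S: "subring_set S" and q: "q \<in> poly_set S" and r: "r \<in> poly_set S"
  shows "pcompose q r \<in> poly_set S"
  using q
proof (induction q)
  case 0
  then show ?case by simp
next
  case (pCons a q)
  have "a \<in> S" and q: "q \<in> poly_set S"
    using pCons.prems unfolding poly_set_def
    by (auto simp: coeff_pCons split: nat.splits dest: spec[of _ 0] spec[of _ "Suc _"])
  then have "[:a:] \<in> poly_set S"
    using S by (auto simp: poly_set_def coeff_pCons split: nat.splits intro: subring_set_0)
  then show ?case
    using pCons.IH[OF q] r subring_set_poly_set[OF S]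
    by (auto simp: pcompose_pCons intro!: subring_set_add subring_set_mult)
qed

fun poly_iterate :: "'b::comm_ring_1 poly \<Rightarrow> nat \<Rightarrow> 'b poly" where
  "poly_iterate f 0 = [:0, 1:]"
| "poly_iterate f (Suc j) = pcompose f (poly_iterate f j)"

text \<open>The definition puts the new f outside, which matches stepping down the chain of roots;
  the substitution T \<mapsto> f(T) puts it inside. Their agreement makes the substitution an index
  shift on the F_j.\<close>

lemma pcompose_poly_iterate: "pcompose (poly_iterate f j) f = poly_iterate f (Suc j)"
  by (induction j) (simp_all add: pcompose_pCons pcompose_assoc[symmetric])

context padic_algebraic_closure
begin

section \<open>The absolute value\<close>

lemma v_0 [simp]: "v 0 = 0"
  by (simp add: v_eq_0_iff)

lemma v_1 [simp]: "v 1 = 1"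
  using v_mult[of 1 1] v_eq_0_iff[of 1] by simp

lemma v_power: "v (x ^ n) = v x ^ n"
  by (induction n) (auto simp: v_mult)

lemma v_minus_1: "v (- 1) = 1"
proof -
  have "v (- 1) ^ 2 = 1"
    using v_power[of "- 1" 2] by simp
  then show ?thesis
    using v_nonneg[of "- 1"] by (simp add: power2_eq_1_iff)
qed

lemma v_minus [simp]: "v (- x) = v x"
  using v_mult[of "- 1" x] v_minus_1 by simp

lemma v_minus_commute: "v (x - y) = v (y - x)"
  using v_minus[of "x - y"] by simp

lemma v_diff_le_max: "v (x - y) \<le> max (v x) (v y)"
  using v_add_le_max[of x "- y"] by simp

lemma v_add_le: "v x \<le> c \<Longrightarrow> v y \<le> c \<Longrightarrow> v (x + y) \<le> c"
  using v_add_le_max[of x y] by simp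

lemma v_diff_le: "v x \<le> c \<Longrightarrow> v y \<le> c \<Longrightarrow> v (x - y) \<le> c"
  using v_diff_le_max[of x y] by simp

lemma v_sum_le: "c \<ge> 0 \<Longrightarrow> (\<And>i. i \<in> I \<Longrightarrow> v (g i) \<le> c) \<Longrightarrow> v (sum g I) \<le> c"
  by (induction I rule: infinite_finite_induct) (auto intro: v_add_le)

lemma v_inverse: "v (inverse x) = inverse (v x)"
proof (cases "x = 0")
  case False
  then have "v (inverse x) * v x = 1"
    using v_mult[of "inverse x" x] by simp
  then show ?thesis
    using inverse_unique[of "v x" "v (inverse x)"] by (simp add: mult.commute)
qed simp

lemma v_divide: "v (x / y) = v x / v y"
  by (simp add: divide_inverse v_mult v_inverse)

lemma v_prod: "v (prod g I) = (\<Prod>i\<in>I. v (g i))"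
  by (induction I rule: infinite_finite_induct) (auto simp: v_mult)

lemma v_of_nat_le_1: "v (of_nat n) \<le> 1"
  by (induction n) (auto intro: v_add_le)

lemma v_of_int_le_1: "v (of_int n) \<le> 1"
  by (cases n rule: int_cases2) (auto simp: v_of_nat_le_1)

lemma v_eq_if_close:
  assumes "v (x - y) < v x"
  shows "v y = v x"
proof (rule antisym)
  show "v y \<le> v x"
    using v_diff_le_max[of x "x - y"] assms by simp
  show "v x \<le> v y"
    using v_add_le_max[of "x - y" y] assms by simp
qed

lemma p_gt_1: "p > 1"
  using prime_p prime_gt_1_nat by blast

lemma v_of_int_mult_p_less_1: "v (of_int (a * int p)) < 1"
proof -
  have "v (of_int (a * int p)) = v (of_int a) / real p"
    by (simp add: v_mult v_p)
  also have "\<dots> \<le> 1 / real p"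
    using v_of_int_le_1 by (simp add: divide_right_mono)
  also have "\<dots> < 1" using p_gt_1 by simp
  finally show ?thesis .
qed

text \<open>Bezout: otherwise 1 = a p + b n would be a sum of two elements of absolute value below
  1. Together with \<open>v_p\<close> this fixes v on the integers.\<close>

lemma v_of_int_coprime:
  assumes "\<not> int p dvd n"
  shows "v (of_int n) = 1"
proof (rule ccontr)
  assume "v (of_int n) \<noteq> 1"
  then have less: "v (of_int n) < 1"
    using v_of_int_le_1[of n] by simp
  have "coprime (int p) n"
    using assms prime_p by (simp add: prime_imp_coprime)
  then obtain a b where ab: "a * int p + b * n = 1"
    by (metis bezout_int coprime_imp_gcd_eq_1)
  have "v (of_int (a * int p)) < 1"
    by (rule v_of_int_mult_p_less_1)
  moreover have "v (of_int (b * n)) < 1"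
    using mult_left_le_one_le[of "v (of_int n)" "v (of_int b)"] v_of_int_le_1[of b] less
      v_nonneg[of "of_int b"] v_nonneg[of "of_int n"] by (simp add: v_mult)
  ultimately have "v (of_int (a * int p + b * n)) < 1"
    using v_add_le_max[of "of_int (a * int p)" "of_int (b * n)"] by simp
  then show False using ab by simp
qed

lemma v_of_nat_coprime: "\<not> p dvd n \<Longrightarrow> v (of_nat n) = 1"
  using v_of_int_coprime[of "int n"] by simp

text \<open>Measures the loss from integrating a power series: dividing by n costs at most a factor
  n, which any geometric gain in the radius absorbs.\<close>

lemma v_of_nat_ge: "n > 0 \<Longrightarrow> 1 / real n \<le> v (of_nat n)"
proof (induction n rule: less_induct)
  case (less n)
  show ?case
  proof (cases "p dvd n")
    case True
    then obtain m where m: "n = p * m" by blast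
    have "m > 0" "m < n" using m less.prems p_gt_1 by auto
    then have "1 / real m \<le> v (of_nat m)" by (intro less.IH)
    then have "1 / real p * (1 / real m) \<le> 1 / real p * v (of_nat m)"
      by (intro mult_left_mono) auto
    then show ?thesis by (simp add: m v_mult v_p)
  qed (use less.prems in \<open>simp add: v_of_nat_coprime\<close>)
qed

text \<open>Legendre's recursion: only the multiples of p contribute, and dividing those by p leaves
  the factorial of n div p.\<close>

lemma v_fact_eq: "v (fact n) = (1 / real p) ^ (n div p) * v (fact (n div p))"
proof -
  have "(fact n :: 'a) = of_nat (\<Prod>{1..n})"
    by (simp add: fact_prod)
  then have "v (fact n) = (\<Prod>i\<in>{1..n}. v (of_nat i))"
    by (simp add: v_prod)
  also have "\<dots> = (\<Prod>i\<in>{i\<in>{1..n}. p dvd i}. v (of_nat i))"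
    by (intro prod.mono_neutral_right) (auto simp: v_of_nat_coprime)
  also have "{i\<in>{1..n}. p dvd i} = (*) p ` {1..n div p}"
    using p_gt_1 by (auto simp: image_iff less_eq_div_iff_mult_less_eq mult.commute elim!: dvdE)
  also have "(\<Prod>i\<in>\<dots>. v (of_nat i)) = (\<Prod>i\<in>{1..n div p}. v (of_nat (p * i)))"
    using p_gt_1 by (subst prod.reindex) (auto simp: inj_on_def)
  also have "\<dots> = (1 / real p) ^ (n div p) * (\<Prod>i\<in>{1..n div p}. v (of_nat i))"
    unfolding of_nat_mult v_mult v_p prod.distrib by simp
  also have "(\<Prod>i\<in>{1..n div p}. v (of_nat i)) = v (fact (n div p))"
    by (simp add: fact_prod v_prod)
  finally show ?thesis .
qed

text \<open>A weak form of Legendre's bound ord_p(n!) \<le> n/(p-1), which is at most n/2 for p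
  \<ge> 3. Squaring avoids fractional exponents. With m = n div p the recursion costs 2m + m = 3m
  \<le> n factors 1/p.\<close>

lemma v_fact_sqr_ge:
  assumes "odd p"
  shows "(1 / real p) ^ n \<le> v (fact n) ^ 2"
proof (induction n rule: less_induct)
  case (less n)
  have p3: "p \<ge> 3" using p_gt_1 assms by (cases "p = 2") auto
  show ?case
  proof (cases "n = 0")
    case False
    define m where "m = n div p"
    have "m < n" using False p_gt_1 by (simp add: m_def)
    have "3 * m \<le> n"
      using p3 by (metis m_def div_times_less_eq_dividend le_trans mult.commute mult_le_mono1)
    then have "(1 / real p) ^ n \<le> (1 / real p) ^ (2 * m + m)"
      using p_gt_1 by (intro power_decreasing) auto
    also have "\<dots> = ((1 / real p) ^ m) ^ 2 * (1 / real p) ^ m"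
      by (simp only: power_add power_even_eq)
    also have "\<dots> \<le> ((1 / real p) ^ m) ^ 2 * v (fact m) ^ 2"
      using less.IH[OF \<open>m < n\<close>] by (intro mult_left_mono) auto
    also have "\<dots> = v (fact n) ^ 2"
      unfolding v_fact_eq[of n] m_def by (simp add: power_mult_distrib)
    finally show ?thesis .
  qed simp
qed

lemma v_fact_ge:
  assumes "odd p"
  shows "sqrt (1 / real p) ^ n \<le> v (fact n)"
proof (rule power2_le_imp_le)
  have "(sqrt (1 / real p) ^ n)\<^sup>2 = (sqrt (1 / real p) ^ 2) ^ n"
    by (metis mult.commute power_mult)
  also have "\<dots> \<le> (v (fact n))\<^sup>2"
    using v_fact_sqr_ge[OF assms, of n] by simp
  finally show "(sqrt (1 / real p) ^ n)\<^sup>2 \<le> (v (fact n))\<^sup>2" .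
qed (rule v_nonneg)

text \<open>The bound on the factorial suffices for n \<ge> 2 because then 2(n - 1) \<ge> n.\<close>

lemma v_prime_power_div_fact_le:
  assumes "odd p" "n > 0"
  shows "v (of_nat p ^ (n - 1) / fact n) \<le> 1"
proof (cases "n = 1")
  case False
  have "((1 / real p) ^ (n - 1)) ^ 2 = (1 / real p) ^ (2 * (n - 1))"
    by (simp only: power_even_eq)
  also have "\<dots> \<le> (1 / real p) ^ n"
    using assms False p_gt_1 by (intro power_decreasing) auto
  also have "\<dots> \<le> v (fact n) ^ 2" using assms by (intro v_fact_sqr_ge)
  finally have "(1 / real p) ^ (n - 1) \<le> v (fact n)"
    using v_nonneg by (rule power2_le_imp_le)
  moreover have "v (fact n) > 0" 
    using v_nonneg[of "fact n"] v_eq_0_iff[of "fact n"] by simp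
  ultimately show ?thesis
    by (simp add: v_divide v_power v_p)
qed simp

section \<open>Q_p and Z_p as closures of the rationals, and Fermat's congruence\<close>

lemma rat_closure_of_rat: "of_rat q \<in> rat_closure v"
  by (auto simp: rat_closure_def intro!: exI[of _ q])

lemma subring_set_rat_closure: "subring_set (rat_closure v)"
  unfolding subring_set_def
proof (intro conjI ballI)
  show "1 \<in> rat_closure v" using rat_closure_of_rat[of 1] by simp
next
  fix x y assume xy: "x \<in> rat_closure v" "y \<in> rat_closure v"
  show "x - y \<in> rat_closure v"
    unfolding rat_closure_def
  proof (intro CollectI allI impI)
    fix e :: real assume "e > 0"
    then obtain q s where qs: "v (x - of_rat q) < e" "v (y - of_rat s) < e"
      using xy unfolding rat_closure_def by blast
    have "v ((x - of_rat q) - (y - of_rat s)) < e"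
      using v_diff_le_max[of "x - of_rat q" "y - of_rat s"] qs by linarith
    then show "\<exists>q. v (x - y - of_rat q) < e"
      by (intro exI[of _ "q - s"]) (simp add: of_rat_diff algebra_simps)
  qed
  show "x * y \<in> rat_closure v"
    unfolding rat_closure_def
  proof (intro CollectI allI impI)
    fix e :: real assume e: "e > 0"
    define M where "M = max 1 (max (v x) (v y))"
    have M: "M \<ge> 1" "v x \<le> M" "v y \<le> M" by (auto simp: M_def)
    \<comment> \<open>As d \<le> 1 \<le> M, the approximant \<open>of_rat s\<close> is bounded by M
      too; the 2 makes the final estimate strict.\<close>
    define d where "d = min 1 (e / (2 * M))"
    have d: "d > 0" "d \<le> 1" "M * d < e"
      using e M by (auto simp: d_def min_def field_simps)
    obtain q s where qs: "v (x - of_rat q) < d" "v (y - of_rat s) < d"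
      using d(1) xy unfolding rat_closure_def by blast
    have "v (of_rat s) \<le> M"
      using v_diff_le_max[of y "y - of_rat s"] qs M d by simp
    have "x * y - of_rat (q * s) = x * (y - of_rat s) + of_rat s * (x - of_rat q)"
      by (simp add: of_rat_mult algebra_simps)
    also have "v \<dots> \<le> M * d"
      using qs M d \<open>v (of_rat s) \<le> M\<close>
      by (intro v_add_le) (auto simp: v_mult intro!: mult_mono v_nonneg)
    finally show "\<exists>q. v (x * y - of_rat q) < e"
      using d(3) by (intro exI[of _ "q * s"]) simp
  qed
qed

lemma rat_closure_inverse:
  assumes "x \<in> rat_closure v"
  shows "inverse x \<in> rat_closure v"
proof (cases "x = 0")
  case False
  then have vx: "v x > 0" using v_nonneg[of x] v_eq_0_iff[of x] by simp
  show ?thesis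
    unfolding rat_closure_def
  proof (intro CollectI allI impI)
    fix e :: real assume e: "e > 0"
    \<comment> \<open>Closeness below v x forces q to have the same absolute value as x; the second
      entry then cancels the denominator x q.\<close>
    then have "min (v x) (e * (v x * v x)) > 0" using vx by simp
    then obtain q where q: "v (x - of_rat q) < min (v x) (e * (v x * v x))"
      using assms unfolding rat_closure_def by blast
    then have vq: "v (of_rat q) = v x" by (intro v_eq_if_close) simp
    then have "of_rat q \<noteq> (0 :: 'a)" using vx by auto
    then have "inverse x - of_rat (inverse q) = (of_rat q - x) / (x * of_rat q)"
      using False inverse_diff_inverse[of x "of_rat q"]
      by (simp only: of_rat_inverse) (simp add: divide_inverse algebra_simps)
    then have "v (inverse x - of_rat (inverse q)) = v (x - of_rat q) / (v x * v x)"
      by (simp add: v_divide v_mult vq v_minus_commute)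
    also have "\<dots> < e" using q vx by (simp add: field_simps)
    finally show "\<exists>q. v (inverse x - of_rat q) < e" by blast
  qed
qed (use rat_closure_of_rat[of 0] in simp)

lemma subring_set_padic_integers: "subring_set (padic_integers v)"
  using subring_set_rat_closure v_nonneg
  unfolding subring_set_def padic_integers_def
  by (auto intro: v_diff_le mult_le_one simp: v_mult)

text \<open>The ideal p Z_p is the disc of radius 1/p. This turns estimates into the divisibility
  that \<open>cong_set\<close> asks for.\<close>

lemma padic_integers_eq_v_le_1:
  assumes "x \<in> rat_closure v" "v x \<le> 1 / real p"
  obtains y where "y \<in> padic_integers v" "x = of_nat p * y"
proof
  have p0: "(of_nat p :: 'a) \<noteq> 0" using p_gt_1 by simp
  have "inverse (of_nat p) \<in> rat_closure v"
    using rat_closure_of_rat[of "of_nat p"] by (intro rat_closure_inverse) simp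
  then have "x * inverse (of_nat p) \<in> rat_closure v"
    using assms subring_set_mult[OF subring_set_rat_closure] by blast
  moreover have "v (x / of_nat p) \<le> 1"
    using assms(2) p_gt_1 by (simp add: v_divide v_p field_simps)
  ultimately show "x / of_nat p \<in> padic_integers v"
    by (simp add: padic_integers_def divide_inverse)
  show "x = of_nat p * (x / of_nat p)" using p0 by simp
qed

text \<open>For q = a/b in lowest terms b is prime to p, and a^p b - a b^p = (a^p - a) b - a (b^p -
  b), so Fermat's little theorem for integers applies.\<close>

lemma v_of_rat_le_1_fermat:
  assumes "v (of_rat q) \<le> 1"
  shows "v (of_rat q ^ p - of_rat q) \<le> 1 / real p"
proof -
  obtain a b where ab: "q = Rat.Fract a b" "b > 0" "coprime a b"
    by (cases q) auto
  then have q: "(of_rat q :: 'a) = of_int a / of_int b"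
    by (simp add: of_rat_rat)
  have nd: "\<not> int p dvd b"
  proof
    assume "int p dvd b"
    then obtain c where c: "b = int p * c" by blast
    have "\<not> int p dvd a"
      using ab(3) \<open>int p dvd b\<close> prime_p
      by (metis coprime_common_divisor not_prime_unit prime_nat_int_transfer)
    then have "v (of_int a) = 1" by (rule v_of_int_coprime)
    moreover have "v (of_int b) < 1"
      using v_of_int_mult_p_less_1[of c] by (simp add: c mult.commute)
    moreover have "v (of_int b) > 0"
      using v_nonneg[of "of_int b"] v_eq_0_iff[of "of_int b"] ab(2) by simp
    ultimately show False
      using assms by (simp add: q v_divide field_simps)
  qed
  then have vb: "v (of_int b) = 1" by (rule v_of_int_coprime)
  have "int p dvd a ^ p * b - a * b ^ p"
  proof -
    have UNIV: "subring_set (UNIV :: int set)" by (simp add: subring_set_def)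
    have step: "int p dvd (c + 1) ^ p - (c ^ p + 1)" for c :: int
      using freshman_add[OF UNIV prime_p, of c 1] by (auto simp: cong_set_def)
    have fl: "int p dvd c ^ p - c" for c :: int
    proof (induction c rule: int_induct[of _ 0])
      case base
      then show ?case using p_gt_1 by (simp add: zero_power)
    next
      case (step1 c)
      then show ?case using dvd_add[OF step[of c] step1(2)] by (simp add: algebra_simps)
    next
      case (step2 c)
      have "(c - 1) ^ p - (c - 1) = (c ^ p - c) - ((c - 1 + 1) ^ p - ((c - 1) ^ p + 1))"
        by simp
      also have "int p dvd \<dots>" by (intro dvd_diff step step2(2))
      finally show ?case .
    qed
    have "int p dvd (a ^ p - a) * b - a * (b ^ p - b)"
      by (intro dvd_diff dvd_mult[OF fl] dvd_mult2[OF fl])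
    then show ?thesis by (simp add: algebra_simps)
  qed
  then obtain c where c: "a ^ p * b - a * b ^ p = int p * c" by blast
  have b0: "(of_int b :: 'a) \<noteq> 0" using ab by simp
  have "of_rat q ^ p - of_rat q = ((of_int a :: 'a) ^ p * of_int b - of_int a * of_int b ^ p) / of_int b ^ (p + 1)"
    unfolding q using b0 by (simp add: power_divide diff_divide_distrib)
  also have "\<dots> = of_int (int p * c) / (of_int b ^ (p + 1) :: 'a)"
    unfolding c[symmetric] by simp
  also have "v \<dots> = v (of_int c) / real p"
    using vb by (simp add: v_divide v_mult v_p v_power)
  also have "\<dots> \<le> 1 / real p"
    using v_of_int_le_1 by (simp add: divide_right_mono)
  finally show ?thesis .
qed

text \<open>The residue field is F_p: a rational at distance below 1/p from x is congruent to x
  modulo p, and x inherits the congruence from it.\<close>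

lemma padic_integers_fermat:
  assumes "x \<in> padic_integers v"
  shows "cong_set (padic_integers v) (of_nat p) (x ^ p) x"
proof -
  note S = subring_set_padic_integers
  have p0: "1 / real p > 0" "1 / real p < 1" using p_gt_1 by auto
  obtain q where q: "v (x - of_rat q) < 1 / real p"
    using assms p0 unfolding padic_integers_def rat_closure_def by blast
  have q1: "v (of_rat q) \<le> 1"
    using v_diff_le[of x 1 "x - of_rat q"] assms q p0 by (simp add: padic_integers_def)
  then have qS: "of_rat q \<in> padic_integers v"
    by (simp add: padic_integers_def rat_closure_of_rat)
  have "x - of_rat q \<in> rat_closure v"
    using assms by (intro subring_set_diff subring_set_rat_closure rat_closure_of_rat)
      (simp add: padic_integers_def)
  then obtain y where y: "y \<in> padic_integers v" "x - of_rat q = of_nat p * y"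
    using q by (elim padic_integers_eq_v_le_1) auto
  obtain z where z: "z \<in> padic_integers v" "of_rat q ^ p - of_rat q = of_nat p * z"
    using padic_integers_eq_v_le_1[OF _ v_of_rat_le_1_fermat[OF q1]]
      rat_closure_of_rat[of "q ^ p - q"] by (auto simp: of_rat_diff of_rat_power)
  have xq: "cong_set (padic_integers v) (of_nat p) x (of_rat q)"
    using y by (auto simp: cong_set_def)
  have pow: "cong_set (padic_integers v) (of_nat p) (x ^ n) (of_rat q ^ n)" for n
    by (induction n) (auto intro!: cong_set_mult cong_set_refl S xq assms subring_set_power qS)
  have "cong_set (padic_integers v) (of_nat p) (of_rat q ^ p) (of_rat q)"
    using z by (auto simp: cong_set_def)
  then show ?thesis
    using pow[of p] xq S by (metis cong_set_sym cong_set_trans)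
qed

section \<open>Exponentials of polynomials\<close>

text \<open>The Gauss norm on the disc of radius r, sup of v(F_k) r^k, is at most c; phrased as a
  bound so that no supremum has to exist.\<close>

definition gauss_bounded :: "real \<Rightarrow> real \<Rightarrow> 'a fps \<Rightarrow> bool" where
  "gauss_bounded r c F \<longleftrightarrow> (\<forall>k. v (fps_nth F k) * r ^ k \<le> c)"

lemma gauss_bounded_nonneg: "gauss_bounded r c F \<Longrightarrow> 0 \<le> c"
  unfolding gauss_bounded_def
  by (metis (no_types) mult.right_neutral order_trans power_0 v_nonneg)

lemma gauss_bounded_mono: "gauss_bounded r c F \<Longrightarrow> c \<le> c' \<Longrightarrow> gauss_bounded r c' F"
  unfolding gauss_bounded_def by (meson order_trans)

lemma gauss_bounded_mono_radius:
  assumes "gauss_bounded r c F" "0 \<le> r'" "r' \<le> r"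
  shows "gauss_bounded r' c F"
  unfolding gauss_bounded_def
proof
  fix k
  have "v (fps_nth F k) * r' ^ k \<le> v (fps_nth F k) * r ^ k"
    using assms v_nonneg by (intro mult_left_mono power_mono)
  then show "v (fps_nth F k) * r' ^ k \<le> c"
    using assms(1) unfolding gauss_bounded_def by (meson order_trans)
qed

lemma gauss_bounded_add:
  assumes "gauss_bounded r c F" "gauss_bounded r c G" "r \<ge> 0"
  shows "gauss_bounded r c (F + G)"
  unfolding gauss_bounded_def
proof
  fix k
  have "v (fps_nth (F + G) k) * r ^ k \<le> max (v (fps_nth F k)) (v (fps_nth G k)) * r ^ k"
    using assms(3) by (intro mult_right_mono) (auto intro: v_add_le_max)
  also have "\<dots> \<le> c"
    using assms(1,2) unfolding gauss_bounded_def max_def by auto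
  finally show "v (fps_nth (F + G) k) * r ^ k \<le> c" .
qed

lemma gauss_bounded_uminus: "gauss_bounded r c F \<Longrightarrow> gauss_bounded r c (- F)"
  by (simp add: gauss_bounded_def)

lemma gauss_bounded_diff:
  "gauss_bounded r c F \<Longrightarrow> gauss_bounded r c G \<Longrightarrow> r \<ge> 0 \<Longrightarrow> gauss_bounded r c (F - G)"
  using gauss_bounded_add[of r c F "- G"] gauss_bounded_uminus by simp

lemma gauss_bounded_1: "r \<ge> 0 \<Longrightarrow> gauss_bounded r 1 1"
  by (auto simp: gauss_bounded_def)

lemma v_sum_mult_le:
  assumes "r \<ge> 0" "c \<ge> 0" "\<And>i. i \<in> I \<Longrightarrow> v (g i) * r \<le> c"
  shows "v (sum g I) * r \<le> c"
proof (cases "r = 0")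
  case False
  then have "v (sum g I) \<le> c / r"
    using assms by (intro v_sum_le) (auto simp: field_simps)
  then show ?thesis using False assms(1) by (simp add: field_simps)
qed (use assms in simp)

lemma gauss_bounded_mult:
  assumes F: "gauss_bounded r a F" and G: "gauss_bounded r b G" and r: "r \<ge> 0"
  shows "gauss_bounded r (a * b) (F * G)"
  unfolding gauss_bounded_def
proof
  fix k
  have ab: "a \<ge> 0" "b \<ge> 0" using F G by (auto intro: gauss_bounded_nonneg)
  show "v (fps_nth (F * G) k) * r ^ k \<le> a * b"
    unfolding fps_mult_nth
  proof (rule v_sum_mult_le)
    fix i assume "i \<in> {0..k}"
    then have "r ^ k = r ^ i * r ^ (k - i)" by (simp flip: power_add)
    then have "v (fps_nth F i * fps_nth G (k - i)) * r ^ k =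
        (v (fps_nth F i) * r ^ i) * (v (fps_nth G (k - i)) * r ^ (k - i))"
      by (simp add: v_mult)
    also have "\<dots> \<le> a * b"
      using F G ab r unfolding gauss_bounded_def by (intro mult_mono) (auto simp: v_nonneg)
    finally show "v (fps_nth F i * fps_nth G (k - i)) * r ^ k \<le> a * b" .
  qed (use ab r in auto)
qed

lemma gauss_bounded_power:
  "gauss_bounded r a F \<Longrightarrow> r \<ge> 0 \<Longrightarrow> gauss_bounded r (a ^ n) (F ^ n)"
  by (induction n) (auto intro: gauss_bounded_1 gauss_bounded_mult)

lemma gauss_bounded_compose:
  assumes G: "gauss_bounded r a G" and r: "r \<ge> 0" and E: "\<And>i. v (fps_nth E i) * a ^ i \<le> b"
  shows "gauss_bounded r b (E oo G)"
  unfolding gauss_bounded_def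
proof
  fix k
  have b: "b \<ge> 0" using E[of 0] v_nonneg[of "fps_nth E 0"] by simp
  show "v (fps_nth (E oo G) k) * r ^ k \<le> b"
    unfolding fps_compose_nth
  proof (rule v_sum_mult_le)
    fix i
    have "v (fps_nth E i * fps_nth (G ^ i) k) * r ^ k = v (fps_nth E i) * (v (fps_nth (G ^ i) k) * r ^ k)"
      by (simp add: v_mult)
    also have "\<dots> \<le> v (fps_nth E i) * a ^ i"
      using gauss_bounded_power[OF G r, of i] unfolding gauss_bounded_def
      by (intro mult_left_mono) (auto simp: v_nonneg)
    also have "\<dots> \<le> b" by (rule E)
    finally show "v (fps_nth E i * fps_nth (G ^ i) k) * r ^ k \<le> b" .
  qed (use b r in auto)
qed

lemma gauss_bounded_deriv:
  assumes F: "gauss_bounded r a F" and r: "r > 0"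
  shows "gauss_bounded r (a / r) (fps_deriv F)"
  unfolding gauss_bounded_def
proof
  fix k
  have "v (fps_nth (fps_deriv F) k) * r ^ k = v (of_nat (Suc k)) * (v (fps_nth F (Suc k)) * r ^ k)"
    by (simp add: v_mult del: of_nat_Suc)
  also have "\<dots> \<le> 1 * (v (fps_nth F (Suc k)) * r ^ k)"
    using r v_nonneg by (intro mult_right_mono v_of_nat_le_1) auto
  also have "\<dots> = (v (fps_nth F (Suc k)) * r ^ Suc k) / r"
    using r by simp
  also have "\<dots> \<le> a / r"
    using F r unfolding gauss_bounded_def by (intro divide_right_mono) (blast, simp)
  finally show "v (fps_nth (fps_deriv F) k) * r ^ k \<le> a / r" .
qed

text \<open>I = 1/(1 + D) satisfies I = 1 - D I, and D has no constant term, so each coefficient of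
  I comes from earlier ones; the ultrametric inequality keeps the bound 1.\<close>

lemma gauss_bounded_inverse:
  assumes D: "gauss_bounded r 1 D" and r: "r \<ge> 0" and D0: "fps_nth D 0 = 0"
  shows "gauss_bounded r 1 (inverse (1 + D))"
proof -
  define I where "I = inverse (1 + D)"
  have "(1 + D) * I = 1"
    using D0 by (simp add: I_def inverse_mult_eq_1')
  then have I: "I = 1 - D * I" by (simp add: algebra_simps)
  have "v (fps_nth I k) * r ^ k \<le> 1" for k
  proof (induction k rule: less_induct)
    case (less k)
    show ?case
    proof (cases "k = 0")
      case True
      then show ?thesis using arg_cong[OF I, of "\<lambda>F. fps_nth F 0"] D0 by simp
    next
      case False
      have "fps_nth I k = - fps_nth (D * I) k"
        using False arg_cong[OF I, of "\<lambda>F. fps_nth F k"] by simp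
      also have "v \<dots> * r ^ k \<le> 1"
        unfolding v_minus fps_mult_nth
      proof (rule v_sum_mult_le)
        fix i assume i: "i \<in> {0..k}"
        show "v (fps_nth D i * fps_nth I (k - i)) * r ^ k \<le> 1"
        proof (cases "i = 0")
          case False
          have "r ^ k = r ^ i * r ^ (k - i)" using i by (simp flip: power_add)
          then have "v (fps_nth D i * fps_nth I (k - i)) * r ^ k =
              (v (fps_nth D i) * r ^ i) * (v (fps_nth I (k - i)) * r ^ (k - i))"
            by (simp add: v_mult)
          also have "\<dots> \<le> 1"
            using D r less[of "k - i"] False i unfolding gauss_bounded_def
            by (intro mult_le_one[of "_ * _" "_ * _"]) (auto simp: v_nonneg)
          finally show ?thesis .
        qed (simp add: D0)
      qed (use r in auto)
      finally show ?thesis .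
    qed
  qed
  then show ?thesis by (simp add: gauss_bounded_def I_def)
qed

lemma gauss_bounded_polynomial:
  assumes "\<And>k. k > N \<Longrightarrow> fps_nth F k = 0"
  obtains c where "gauss_bounded r c F"
proof
  show "gauss_bounded r (Max (insert 0 ((\<lambda>k. v (fps_nth F k) * r ^ k) ` {..N}))) F"
    unfolding gauss_bounded_def
  proof
    fix k
    show "v (fps_nth F k) * r ^ k \<le> Max (insert 0 ((\<lambda>k. v (fps_nth F k) * r ^ k) ` {..N}))"
      using assms[of k] by (cases "k \<le> N") (auto intro!: Max_ge simp del: Max_insert)
  qed
qed

text \<open>By continuity in r at 1, a strict bound at radius 1 survives on a slightly larger disc
  for the finitely many coefficients of index at most K.\<close>

lemma exists_radius_gt_1:
  fixes \<rho> c :: real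
  assumes "\<rho> < c"
  obtains r where "r > 1" "r ^ K * \<rho> \<le> c"
proof -
  have "((\<lambda>r. r ^ K * \<rho>) \<longlongrightarrow> 1 ^ K * \<rho>) (at_right 1)"
    by (intro tendsto_intros)
  then have "\<forall>\<^sub>F r in at_right 1. r ^ K * \<rho> < c"
    using assms by (intro order_tendstoD(2)) auto
  then obtain b where b: "b > 1" "\<And>r. r > 1 \<Longrightarrow> r < b \<Longrightarrow> r ^ K * \<rho> < c"
    unfolding eventually_at_right_field by blast
  obtain r where "1 < r" "r < b" using dense[OF b(1)] by blast
  then show ?thesis using b(2)[of r] by (intro that[of r]) auto
qed

lemma is_exp_fps_fps_exp: "is_exp_fps (fps_exp 1 :: 'a fps)"
  by (simp add: is_exp_fps_def fps_exp_def)

text \<open>\<open>fps_ln 1\<close> is the series of log(1 + X). The crude chain v(1/i) \<le> i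
  \<le> 2^(i-1) \<le> p^(i-1) shows that the term C^i / i is no larger than the bound 1/p for C
  itself.\<close>

lemma gauss_bounded_ln_compose:
  assumes "gauss_bounded 1 (1 / real p) C"
  shows "gauss_bounded 1 (1 / real p) (fps_ln 1 oo C)"
proof (rule gauss_bounded_compose[OF assms])
  fix i
  show "v (fps_nth (fps_ln 1) i) * (1 / real p) ^ i \<le> 1 / real p"
  proof (cases i)
    case (Suc j)
    have "v (fps_nth (fps_ln 1) i) = inverse (v (of_nat i))"
      by (simp add: Suc fps_ln_nth v_mult v_inverse v_power v_minus_1 divide_inverse del: of_nat_Suc)
    also have "\<dots> \<le> real i"
      using le_imp_inverse_le[OF v_of_nat_ge[of i]] Suc by simp
    also have "real i \<le> real p ^ j"
    proof -
      have "i \<le> 2 ^ j" using less_exp[of j] by (simp add: Suc Suc_leI)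
      also have "\<dots> \<le> p ^ j" using p_gt_1 by (intro power_mono) auto
      finally show ?thesis by (metis of_nat_le_iff of_nat_power)
    qed
    finally have "v (fps_nth (fps_ln 1) i) * (1 / real p) ^ i \<le> real p ^ j * (1 / real p) ^ i"
      by (intro mult_right_mono) auto
    also have "\<dots> = 1 / real p"
      using p_gt_1 by (simp add: Suc power_one_over)
    finally show ?thesis .
  qed simp
qed simp

text \<open>
  Truncating \<open>\<Theta> = exp G\<close> to a polynomial \<open>A\<close> leaves a factor \<open>B = \<Theta> / A\<close> that is congruent to
  \<open>1\<close> modulo \<open>p\<close>. The coefficients of its logarithm are divisible by \<open>p\<close>, and the derivative is
  \<open>G' - A' / A\<close>, whose radius of convergence exceeds \<open>1\<close>; so on a slightly larger disc the
  logarithm stays inside the domain of convergence of the exponential.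
\<close>

lemma exp_polynomial_gauss_bounded:
  fixes G :: "'a fps"
  assumes odd: "odd p" and G0: "fps_nth G 0 = 0" and G: "\<And>k. k > N \<Longrightarrow> fps_nth G k = 0"
    and \<Theta>: "\<Theta> = fps_exp 1 oo G"
    and \<rho>: "\<And>k. k > 0 \<Longrightarrow> v (fps_nth \<Theta> k) \<le> \<rho>" "\<rho> < 1"
    and K: "\<And>k. k \<ge> K \<Longrightarrow> v (fps_nth \<Theta> k) \<le> 1 / real p"
  obtains r where "r > 1" "gauss_bounded r 1 \<Theta>"
proof -
  note E = is_exp_fps_fps_exp
  have p0: "real p > 1" using p_gt_1 by simp
  \<comment> \<open>The finitely many coefficients in \<open>D\<close> are at most \<rho> < 1, so A
    = 1 + D and its inverse stay bounded by 1 at some radius r > 1. What is left for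
    \<open>R\<close> has size at most 1/p.\<close>
  define D where "D = Abs_fps (\<lambda>k. if 0 < k \<and> k < K then fps_nth \<Theta> k else 0)"
  define A where "A = 1 + D"
  define R where "R = \<Theta> - A"
  define C where "C = R * inverse A"
  define B where "B = 1 + C"
  define L where "L = fps_ln 1 oo C"
  have \<Theta>0: "fps_nth \<Theta> 0 = 1" by (simp add: \<Theta>)
  have A0: "fps_nth A 0 = 1" and D0: "fps_nth D 0 = 0" by (auto simp: A_def D_def)
  have R0: "fps_nth R 0 = 0" by (simp add: R_def \<Theta>0 A0)
  have C0: "fps_nth C 0 = 0" by (simp add: C_def R0)
  have B0: "fps_nth B 0 = 1" by (simp add: B_def C0)
  have L0: "fps_nth L 0 = 0" by (simp add: L_def fps_ln_nth)
  have AI: "A * inverse A = 1" using A0 by (simp add: inverse_mult_eq_1')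
  have "A * B = A + R * (A * inverse A)" by (simp add: B_def C_def algebra_simps)
  then have \<Theta>_eq: "\<Theta> = A * B" by (simp add: AI R_def)

  have \<rho>0: "\<rho> \<ge> 0" using \<rho>(1)[of 1] v_nonneg[of "fps_nth \<Theta> 1"] by simp
  obtain r where r: "r > 1" "r ^ K * \<rho> \<le> 1" using exists_radius_gt_1[OF \<rho>(2)] by blast
  have D: "gauss_bounded r 1 D"
    unfolding gauss_bounded_def
  proof
    fix k
    show "v (fps_nth D k) * r ^ k \<le> 1"
    proof (cases "0 < k \<and> k < K")
      case True
      then have "v (fps_nth D k) * r ^ k \<le> \<rho> * r ^ K"
        using \<rho>(1) r \<rho>0 by (intro mult_mono power_increasing) (auto simp: D_def)
      then show ?thesis using r by (simp add: mult.commute)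
    qed (auto simp: D_def)
  qed
  have invA: "gauss_bounded r 1 (inverse A)"
    unfolding A_def using r by (intro gauss_bounded_inverse D D0) auto
  have A: "gauss_bounded r 1 A"
    unfolding A_def using r by (intro gauss_bounded_add gauss_bounded_1 D) auto
  have R: "gauss_bounded 1 (1 / real p) R"
    unfolding gauss_bounded_def
  proof
    fix k
    show "v (fps_nth R k) * 1 ^ k \<le> 1 / real p"
      using K[of k] \<Theta>0 by (cases "k = 0"; cases "k < K") (auto simp: R_def A_def D_def)
  qed
  have C: "gauss_bounded 1 (1 / real p) C"
    unfolding C_def
    using gauss_bounded_mult[OF R gauss_bounded_mono_radius[OF invA]] r by simp
  then have L: "gauss_bounded 1 (1 / real p) L"
    unfolding L_def by (rule gauss_bounded_ln_compose)

  have "fps_deriv L = (inverse (1 + fps_X) oo C) * fps_deriv C"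
    unfolding L_def by (simp add: fps_compose_deriv C0 fps_ln_deriv)
  also have "inverse (1 + fps_X) oo C = inverse B"
    using C0 by (simp add: fps_inverse_compose fps_compose_add_distrib B_def)
  finally have L_deriv: "fps_deriv L = inverse B * fps_deriv C" .
  have "B * inverse B = 1" using B0 by (simp add: inverse_mult_eq_1')
  then have "B * fps_deriv L = fps_deriv C"
    unfolding L_deriv by (simp only: mult.assoc[symmetric] mult_1)
  then have BL: "fps_deriv B = B * fps_deriv L" by (simp add: B_def)
  have B_exp: "B = fps_exp 1 oo L"
    by (rule fps_linear_ode_unique[OF BL])
       (use exp_compose_deriv[OF E L0] B0 in auto)
  \<comment> \<open>Comparing logarithmic derivatives of \<Theta> = A B expresses L' through the
    polynomial G and through A and its inverse, all of which are under control beyond radius 1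
    although B is not yet.\<close>
  have "fps_deriv (A * B) = A * B * fps_deriv G"
    using exp_compose_deriv[OF E G0] unfolding \<Theta>_eq[symmetric] \<Theta> by simp
  then have "A * B * fps_deriv L + fps_deriv A * B = A * B * fps_deriv G"
    by (simp add: BL algebra_simps)
  then have "B * (A * fps_deriv L) = B * (A * fps_deriv G - fps_deriv A)"
    by (simp add: algebra_simps)
  moreover have "B \<noteq> 0" using B0 by auto
  ultimately have "A * fps_deriv L = A * fps_deriv G - fps_deriv A" by simp
  then have "inverse A * (A * fps_deriv L) = inverse A * (A * fps_deriv G - fps_deriv A)"
    by simp
  also have "\<dots> = (A * inverse A) * fps_deriv G - fps_deriv A * inverse A"
    by (simp add: algebra_simps)
  finally have L': "fps_deriv L = fps_deriv G - fps_deriv A * inverse A"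
    using AI by (simp add: mult.assoc[symmetric] mult.commute[of "inverse A"])

  obtain g where g: "gauss_bounded r g G" using gauss_bounded_polynomial[OF G] by blast
  define M where "M = max (g / r) (1 / r * 1)"
  have M: "gauss_bounded r M (fps_deriv L)"
    unfolding L' M_def using r
    by (intro gauss_bounded_diff gauss_bounded_mono[OF gauss_bounded_deriv[OF g]]
          gauss_bounded_mono[OF gauss_bounded_mult[OF gauss_bounded_deriv[OF A] invA]]) auto
  \<comment> \<open>Integration: k L_k is coefficient k - 1 of L', and dividing by k costs at most a
    factor k.\<close>
  have Lk: "v (fps_nth L k) * r ^ k \<le> real k * (M * r)" for k
  proof (cases k)
    case (Suc j)
    have "v (of_nat k) * v (fps_nth L k) * r ^ j \<le> M"
      using M unfolding gauss_bounded_def by (auto simp: v_mult Suc simp del: of_nat_Suc dest: spec[of _ j])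
    moreover have "1 / real k * (v (fps_nth L k) * r ^ j) \<le> v (of_nat k) * (v (fps_nth L k) * r ^ j)"
      using v_of_nat_ge[of k] Suc r by (intro mult_right_mono) (auto simp: v_nonneg)
    ultimately have "1 / real k * (v (fps_nth L k) * r ^ j) \<le> M" by (simp add: mult.assoc)
    then have "v (fps_nth L k) * r ^ j \<le> real k * M"
      using Suc by (simp add: field_simps del: of_nat_Suc)
    then have "v (fps_nth L k) * r ^ j * r \<le> real k * M * r"
      using r by (intro mult_right_mono) auto
    then show ?thesis by (simp add: Suc mult_ac)
  qed (simp add: L0)

  \<comment> \<open>s = p^(-1/2) lies strictly above the bound 1/p for L at radius 1, and by
    \<open>v_fact_ge\<close> the terms of exp at radius s are still at most 1.\<close>
  define s where "s = sqrt (1 / real p)"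
  have s: "s > 0" "1 / real p < s"
  proof -
    show "s > 0" using p0 by (simp add: s_def)
    have "s < 1" using p0 by (simp add: s_def)
    then have "s * s < s * 1" using \<open>s > 0\<close> by (intro mult_strict_left_mono)
    moreover have "s * s = 1 / real p" using p0 by (simp add: s_def)
    ultimately show "1 / real p < s" by simp
  qed
  \<comment> \<open>Passing from r to its square root leaves a surplus factor r1^(-k), which absorbs
    the k lost in the integration once k is large.\<close>
  define r1 where "r1 = sqrt r"
  have r1: "r1 > 1" "r = r1 * r1" using r by (auto simp: r1_def)
  have "(\<lambda>k. real k * (1 / r1) ^ k) \<longlonglongrightarrow> 0"
    using r1 by (intro powser_times_n_limit_0) auto
  then have "(\<lambda>k. (M * r) * (real k * (1 / r1) ^ k)) \<longlonglongrightarrow> 0"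
    by (rule tendsto_mult_right_zero)
  then have "\<forall>\<^sub>F k in sequentially. (M * r) * (real k * (1 / r1) ^ k) < s"
    using s(1) by (rule order_tendstoD(2))
  then obtain K2 where K2: "\<And>k. k \<ge> K2 \<Longrightarrow> (M * r) * (real k * (1 / r1) ^ k) < s"
    unfolding eventually_sequentially by blast
  \<comment> \<open>Indices below K2 have only the bound 1/p at radius 1; being finitely many, they
    stay below s after a small enlargement.\<close>
  obtain r3 where r3: "r3 > 1" "r3 ^ K2 * (1 / real p) \<le> s"
    using exists_radius_gt_1[OF s(2)] by blast
  define r2 where "r2 = min r1 r3"
  have r2: "r2 > 1" "r2 \<le> r1" "r2 \<le> r3" using r1 r3 by (auto simp: r2_def)
  have "r1 * 1 \<le> r1 * r1" using r1 by (intro mult_left_mono) auto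
  then have "r2 \<le> r" using r2 r1 by linarith
  have Ls: "gauss_bounded r2 s L"
    unfolding gauss_bounded_def
  proof
    fix k
    show "v (fps_nth L k) * r2 ^ k \<le> s"
    proof (cases "k < K2")
      case True
      have "r2 ^ k \<le> r2 ^ K2" using r2 True by (intro power_increasing) auto
      also have "\<dots> \<le> r3 ^ K2" using r2 by (intro power_mono) auto
      finally have "v (fps_nth L k) * r2 ^ k \<le> 1 / real p * r3 ^ K2"
        using L r2 unfolding gauss_bounded_def by (intro mult_mono) auto
      then show ?thesis using r3 by (simp add: mult.commute)
    next
      case False
      have "v (fps_nth L k) * r2 ^ k \<le> v (fps_nth L k) * r1 ^ k"
        using r2 by (intro mult_left_mono power_mono) (auto simp: v_nonneg)
      also have "\<dots> = (v (fps_nth L k) * r ^ k) * (1 / r1) ^ k"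
        using r1 by (simp add: power_mult_distrib power_one_over)
      also have "\<dots> \<le> (real k * (M * r)) * (1 / r1) ^ k"
        using r1 by (intro mult_right_mono Lk) auto
      also have "\<dots> \<le> s"
        using K2[of k] False by (simp add: mult_ac)
      finally show ?thesis .
    qed
  qed
  have "gauss_bounded r2 1 B"
    unfolding B_exp
  proof (rule gauss_bounded_compose[OF Ls])
    fix i
    have "v (fact i) > 0"
      using v_nonneg[of "fact i"] v_eq_0_iff[of "fact i"] by simp
    then show "v (fps_nth (fps_exp 1) i) * s ^ i \<le> 1"
      using v_fact_ge[OF odd, of i] by (simp add: fps_exp_def v_divide s_def)
  qed (use r2 in auto)
  then have "gauss_bounded r2 (1 * 1) \<Theta>"
    unfolding \<Theta>_eq using r2 \<open>r2 \<le> r\<close>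
    by (intro gauss_bounded_mult gauss_bounded_mono_radius[OF A]) auto
  then show ?thesis using r2 by (intro that[of r2]) auto
qed

section \<open>Completeness of finite-dimensional subspaces\<close>

definition complete_set :: "'a set \<Rightarrow> bool" where
  "complete_set V \<longleftrightarrow> (\<forall>\<sigma>. (\<forall>n. \<sigma> n \<in> V) \<and> (\<forall>e>0. \<exists>N. \<forall>m\<ge>N. \<forall>n\<ge>N. v (\<sigma> m - \<sigma> n) < e) \<longrightarrow>
     (\<exists>L\<in>V. (\<lambda>n. v (\<sigma> n - L)) \<longlonglongrightarrow> 0))"

lemma complete_set_rat_closure: "complete_set (rat_closure v)"
proof -
  interpret Metric_space "rat_closure v" "\<lambda>x y. v (x - y)"
  proof
    fix x y z
    show "0 \<le> v (x - y)" by (rule v_nonneg)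
    show "v (x - y) = v (y - x)" by (rule v_minus_commute)
    show "v (x - y) = 0 \<longleftrightarrow> x = y" by (simp add: v_eq_0_iff)
    have "v (x - z) \<le> max (v (x - y)) (v (y - z))"
      using v_add_le_max[of "x - y" "y - z"] by simp
    also have "\<dots> \<le> v (x - y) + v (y - z)"
      using v_nonneg[of "x - y"] v_nonneg[of "y - z"] by simp
    finally show "v (x - z) \<le> v (x - y) + v (y - z)" .
  qed
  show ?thesis
    unfolding complete_set_def
  proof (intro allI impI, elim conjE)
    fix \<sigma> :: "nat \<Rightarrow> 'a" assume \<sigma>: "\<forall>n. \<sigma> n \<in> rat_closure v"
      "\<forall>e>0. \<exists>N. \<forall>m\<ge>N. \<forall>n\<ge>N. v (\<sigma> m - \<sigma> n) < e"
    then have "MCauchy \<sigma>"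
      unfolding MCauchy_def by blast
    then obtain L where "limitin mtopology \<sigma> L sequentially"
      using complete unfolding mcomplete_def by blast
    then have L: "L \<in> rat_closure v" "\<forall>e>0. \<forall>\<^sub>F n in sequentially. v (\<sigma> n - L) < e"
      unfolding limitin_metric by (auto elim: eventually_mono)
    then have "(\<lambda>n. v (\<sigma> n - L)) \<longlonglongrightarrow> 0"
      by (intro order_tendstoI) (auto intro!: always_eventually less_le_trans[OF _ v_nonneg])
    then show "\<exists>L\<in>rat_closure v. (\<lambda>n. v (\<sigma> n - L)) \<longlonglongrightarrow> 0"
      using L by blast
  qed
qed

definition subspace_set :: "'a set \<Rightarrow> bool" where
  "subspace_set V \<longleftrightarrow> 0 \<in> V \<and> (\<forall>x\<in>V. \<forall>y\<in>V. x + y \<in> V) \<and> (\<forall>a\<in>rat_closure v. \<forall>x\<in>V. a * x \<in> V)"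

lemma subspace_set_diff:
  assumes "subspace_set V" "x \<in> V" "y \<in> V"
  shows "x - y \<in> V"
proof -
  have "- 1 \<in> rat_closure v" using rat_closure_of_rat[of "- 1"] by (simp add: of_rat_minus)
  then have "- 1 * y \<in> V" using assms unfolding subspace_set_def by blast
  then have "x + - 1 * y \<in> V" using assms unfolding subspace_set_def by blast
  then show ?thesis by simp
qed

lemma subspace_set_sum:
  "subspace_set V \<Longrightarrow> (\<And>i. i \<in> I \<Longrightarrow> g i \<in> V) \<Longrightarrow> sum g I \<in> V"
  by (induction I rule: infinite_finite_induct) (auto simp: subspace_set_def)

text \<open>A complete set is closed: points of V approaching w would form a Cauchy sequence whose
  limit lies in V and equals w.\<close>

lemma complete_set_distance_pos:
  assumes V: "complete_set V" and w: "w \<notin> V"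
  obtains d where "d > 0" "\<And>y. y \<in> V \<Longrightarrow> v (w - y) \<ge> d"
proof -
  have "\<exists>d>0. \<forall>y\<in>V. v (w - y) \<ge> d"
  proof (rule ccontr)
    assume "\<not> ?thesis"
    then have "\<forall>n. \<exists>y\<in>V. v (w - y) < 1 / real (Suc n)"
      by (metis not_le of_nat_0_less_iff zero_less_Suc zero_less_divide_1_iff)
    then obtain \<sigma> where \<sigma>: "\<And>n. \<sigma> n \<in> V" "\<And>n. v (w - \<sigma> n) < 1 / real (Suc n)"
      by metis
    have lim: "(\<lambda>n. v (\<sigma> n - w)) \<longlonglongrightarrow> 0"
    proof (rule tendsto_sandwich[of "\<lambda>_. 0"])
      show "(\<lambda>n. 1 / real (Suc n)) \<longlonglongrightarrow> 0" by (rule LIMSEQ_Suc[OF lim_1_over_n])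
      show "\<forall>\<^sub>F n in sequentially. v (\<sigma> n - w) \<le> 1 / real (Suc n)"
        using \<sigma>(2) by (auto simp: v_minus_commute[of _ w] intro!: always_eventually less_imp_le)
    qed (auto simp: v_nonneg)
    have "\<exists>N. \<forall>m\<ge>N. \<forall>n\<ge>N. v (\<sigma> m - \<sigma> n) < e" if e0: "e > 0" for e
    proof -
      obtain N where N: "\<And>n. n \<ge> N \<Longrightarrow> v (\<sigma> n - w) < e"
        using order_tendstoD(2)[OF lim e0] unfolding eventually_sequentially by blast
      have "v (\<sigma> m - \<sigma> n) < e" if "m \<ge> N" "n \<ge> N" for m n
        using v_diff_le_max[of "\<sigma> m - w" "\<sigma> n - w"] N[OF that(1)] N[OF that(2)] by simp
      then show ?thesis by blast
    qed
    then obtain L where L: "L \<in> V" "(\<lambda>n. v (\<sigma> n - L)) \<longlonglongrightarrow> 0"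
      using V \<sigma>(1) unfolding complete_set_def by blast
    have "(\<lambda>n. max (v (\<sigma> n - w)) (v (\<sigma> n - L))) \<longlonglongrightarrow> max 0 0"
      by (intro tendsto_max lim L)
    moreover have "v (L - w) \<le> max (v (\<sigma> n - w)) (v (\<sigma> n - L))" for n
      using v_diff_le_max[of "\<sigma> n - w" "\<sigma> n - L"] by simp
    ultimately have "v (L - w) \<le> max 0 0"
      by (intro LIMSEQ_le_const) auto
    then have "v (L - w) = 0" using v_nonneg[of "L - w"] by simp
    then show False using w L(1) by (simp add: v_eq_0_iff)
  qed
  then show ?thesis using that by blast
qed

text \<open>The usual induction step for finite-dimensional spaces over a complete field. If w has
  distance at least d > 0 from V, then v(a) \<le> v(y + a w)/d, so both coordinates of a Cauchy
  sequence are Cauchy.\<close>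

lemma complete_set_extend:
  assumes V: "complete_set V" "subspace_set V"
  shows "complete_set {y + a * w | y a. y \<in> V \<and> a \<in> rat_closure v}"
proof (cases "w \<in> V")
  case True
  have "{y + a * w | y a. y \<in> V \<and> a \<in> rat_closure v} = V" (is "?W = V")
  proof
    show "?W \<subseteq> V" using V(2) True unfolding subspace_set_def by blast
    show "V \<subseteq> ?W"
    proof
      fix y assume "y \<in> V"
      then show "y \<in> ?W"
        using subring_set_0[OF subring_set_rat_closure]
        by (intro CollectI exI[of _ y] exI[of _ 0]) auto
    qed
  qed
  then show ?thesis using V by simp
next
  case False
  obtain d where d: "d > 0" "\<And>y. y \<in> V \<Longrightarrow> v (w - y) \<ge> d"
    using complete_set_distance_pos[OF V(1) False] by blast
  have lower: "v a * d \<le> v (y + a * w)" if "y \<in> V" "a \<in> rat_closure v" for a y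
  proof (cases "a = 0")
    case False
    have "- inverse a \<in> rat_closure v"
      using that by (intro subring_set_uminus subring_set_rat_closure rat_closure_inverse)
    then have "- inverse a * y \<in> V" using V(2) that unfolding subspace_set_def by blast
    then have "v a * d \<le> v a * v (w - (- inverse a * y))"
      by (intro mult_left_mono d(2) v_nonneg)
    also have "\<dots> = v (a * (w - (- inverse a * y)))" by (simp add: v_mult)
    also have "a * (w - (- inverse a * y)) = y + a * w" using False by (simp add: algebra_simps)
    finally show ?thesis .
  qed (simp add: v_nonneg)
  show ?thesis
    unfolding complete_set_def
  proof (intro allI impI, elim conjE)
    fix \<sigma> :: "nat \<Rightarrow> 'a" assume "\<forall>n. \<sigma> n \<in> {y + a * w | y a. y \<in> V \<and> a \<in> rat_closure v}"
      and cauchy: "\<forall>e>0. \<exists>N. \<forall>m\<ge>N. \<forall>n\<ge>N. v (\<sigma> m - \<sigma> n) < e"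
    then have "\<forall>n. \<exists>y a. y \<in> V \<and> a \<in> rat_closure v \<and> \<sigma> n = y + a * w" by blast
    then obtain y a where ya: "\<And>n. y n \<in> V" "\<And>n. a n \<in> rat_closure v" "\<And>n. \<sigma> n = y n + a n * w"
      by metis
    have diff: "v (a m - a n) * d \<le> v (\<sigma> m - \<sigma> n)" for m n
    proof -
      have "\<sigma> m - \<sigma> n = (y m - y n) + (a m - a n) * w" by (simp add: ya(3) algebra_simps)
      moreover have "v (a m - a n) * d \<le> v ((y m - y n) + (a m - a n) * w)"
        using ya V(2)
        by (intro lower subspace_set_diff[OF V(2)] subring_set_diff[OF subring_set_rat_closure])
      ultimately show ?thesis by metis
    qed
    have "\<exists>N. \<forall>m\<ge>N. \<forall>n\<ge>N. v (a m - a n) < e" if e0: "e > 0" for e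
    proof -
      obtain N where N: "\<And>m n. m \<ge> N \<Longrightarrow> n \<ge> N \<Longrightarrow> v (\<sigma> m - \<sigma> n) < e * d"
        using cauchy e0 d(1) by (metis mult_pos_pos)
      have "v (a m - a n) < e" if "m \<ge> N" "n \<ge> N" for m n
        using le_less_trans[OF diff N[OF that]] d(1) by simp
      then show ?thesis by blast
    qed
    then obtain b where b: "b \<in> rat_closure v" "(\<lambda>n. v (a n - b)) \<longlonglongrightarrow> 0"
      using complete_set_rat_closure ya(2) unfolding complete_set_def by blast
    have bw: "(\<lambda>n. v ((a n - b) * w)) \<longlonglongrightarrow> 0"
      using tendsto_mult_left_zero[OF b(2), of "v w"] by (simp add: v_mult)
    have "\<exists>N. \<forall>m\<ge>N. \<forall>n\<ge>N. v (y m - y n) < e" if e0: "e > 0" for e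
    proof -
      obtain N1 where N1: "\<And>m n. m \<ge> N1 \<Longrightarrow> n \<ge> N1 \<Longrightarrow> v (\<sigma> m - \<sigma> n) < e"
        using cauchy e0 by metis
      obtain N2 where N2: "\<And>n. n \<ge> N2 \<Longrightarrow> v ((a n - b) * w) < e"
        using order_tendstoD(2)[OF bw e0] unfolding eventually_sequentially by blast
      have "v (y m - y n) < e" if "m \<ge> max N1 N2" "n \<ge> max N1 N2" for m n
      proof -
        have "y m - y n = (\<sigma> m - \<sigma> n) - ((a m - b) * w - (a n - b) * w)"
          by (simp add: ya(3) algebra_simps)
        then show ?thesis
          using v_diff_le_max[of "\<sigma> m - \<sigma> n" "(a m - b) * w - (a n - b) * w"]
            v_diff_le_max[of "(a m - b) * w" "(a n - b) * w"] N1[of m n] N2[of m] N2[of n] that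
          by simp
      qed
      then show ?thesis by blast
    qed
    then obtain z where z: "z \<in> V" "(\<lambda>n. v (y n - z)) \<longlonglongrightarrow> 0"
      using V(1) ya(1) unfolding complete_set_def by blast
    have "(\<lambda>n. v (\<sigma> n - (z + b * w))) \<longlonglongrightarrow> 0"
    proof (rule tendsto_sandwich[of "\<lambda>_. 0"])
      show "(\<lambda>n. max (v (y n - z)) (v ((a n - b) * w))) \<longlonglongrightarrow> 0"
        using tendsto_max[OF z(2) bw] by simp
      have "v (\<sigma> n - (z + b * w)) \<le> max (v (y n - z)) (v ((a n - b) * w))" for n
        using v_add_le_max[of "y n - z" "(a n - b) * w"] by (simp add: ya(3) algebra_simps)
      then show "\<forall>\<^sub>F n in sequentially. v (\<sigma> n - (z + b * w)) \<le> max (v (y n - z)) (v ((a n - b) * w))"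
        by simp
    qed (auto simp: v_nonneg)
    moreover have "z + b * w \<in> {y + a * w | y a. y \<in> V \<and> a \<in> rat_closure v}"
      using z b by blast
    ultimately show "\<exists>L\<in>{y + a * w | y a. y \<in> V \<and> a \<in> rat_closure v}. (\<lambda>n. v (\<sigma> n - L)) \<longlonglongrightarrow> 0"
      by blast
  qed
qed

text \<open>Finite-dimensional subspaces over Q_p, built by adjoining one vector at a time. As w may
  already lie in V, neither bases nor dimensions have to be tracked.\<close>

inductive fin_span :: "'a set \<Rightarrow> bool" where
  fin_span_0: "fin_span {0}"
| fin_span_extend: "fin_span V \<Longrightarrow> fin_span {y + a * w | y a. y \<in> V \<and> a \<in> rat_closure v}"

lemma subspace_set_extend:
  assumes "subspace_set V"
  shows "subspace_set {y + a * w | y a. y \<in> V \<and> a \<in> rat_closure v}"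
  unfolding subspace_set_def
proof (intro conjI ballI)
  note S = subring_set_rat_closure
  show "0 \<in> {y + a * w | y a. y \<in> V \<and> a \<in> rat_closure v}"
    using assms subring_set_0[OF S] unfolding subspace_set_def
    by (intro CollectI exI[of _ 0]) auto
next
  note S = subring_set_rat_closure
  fix s t assume "s \<in> {y + a * w | y a. y \<in> V \<and> a \<in> rat_closure v}"
    "t \<in> {y + a * w | y a. y \<in> V \<and> a \<in> rat_closure v}"
  then obtain y a z b where *: "s = y + a * w" "t = z + b * w" "y \<in> V" "z \<in> V"
    "a \<in> rat_closure v" "b \<in> rat_closure v" by blast
  then have "s + t = (y + z) + (a + b) * w" by (simp add: algebra_simps)
  then show "s + t \<in> {y + a * w | y a. y \<in> V \<and> a \<in> rat_closure v}"
    using * assms subring_set_add[OF S] unfolding subspace_set_def by blast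
next
  note S = subring_set_rat_closure
  fix c s assume c: "c \<in> rat_closure v" and "s \<in> {y + a * w | y a. y \<in> V \<and> a \<in> rat_closure v}"
  then obtain y a where *: "s = y + a * w" "y \<in> V" "a \<in> rat_closure v" by blast
  then have "c * s = c * y + (c * a) * w" by (simp add: algebra_simps)
  then show "c * s \<in> {y + a * w | y a. y \<in> V \<and> a \<in> rat_closure v}"
    using * c assms subring_set_mult[OF S] unfolding subspace_set_def by blast
qed

lemma fin_span_subspace_complete: "fin_span V \<Longrightarrow> subspace_set V \<and> complete_set V"
proof (induction rule: fin_span.induct)
  case fin_span_0
  have "complete_set {0}"
    unfolding complete_set_def by auto
  then show ?case by (simp add: subspace_set_def)
qed (use subspace_set_extend complete_set_extend in blast)

lemma fin_span_plus:
  assumes "fin_span V" "fin_span W"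
  shows "fin_span {x + y | x y. x \<in> V \<and> y \<in> W}"
  using assms(2)
proof (induction rule: fin_span.induct)
  case fin_span_0
  then show ?case using assms(1) by simp
next
  case (fin_span_extend W w)
  have "{x + y | x y. x \<in> V \<and> y \<in> {y + a * w | y a. y \<in> W \<and> a \<in> rat_closure v}} =
      {y + a * w | y a. y \<in> {x + y | x y. x \<in> V \<and> y \<in> W} \<and> a \<in> rat_closure v}"
    (is "?A = ?B")
  proof
    show "?A \<subseteq> ?B"
    proof clarify
      fix x y a assume "x \<in> V" "y \<in> W" "a \<in> rat_closure v"
      then show "\<exists>z b. x + (y + a * w) = z + b * w \<and>
          z \<in> {x + y | x y. x \<in> V \<and> y \<in> W} \<and> b \<in> rat_closure v"
        by (intro exI[of _ "x + y"] exI[of _ a]) (auto simp: add.assoc)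
    qed
    show "?B \<subseteq> ?A"
    proof clarify
      fix x y a assume "x \<in> V" "y \<in> W" "a \<in> rat_closure v"
      then show "\<exists>x' y'. x + y + a * w = x' + y' \<and> x' \<in> V \<and>
          y' \<in> {y + a * w | y a. y \<in> W \<and> a \<in> rat_closure v}"
        by (intro exI[of _ x] exI[of _ "y + a * w"]) (auto simp: add.assoc)
    qed
  qed
  then show ?case using fin_span.fin_span_extend[OF fin_span_extend.IH] by simp
qed

lemma fin_span_scale: "fin_span V \<Longrightarrow> fin_span ((*) c ` V)"
proof (induction rule: fin_span.induct)
  case fin_span_0
  then show ?case by (simp add: fin_span.fin_span_0)
next
  case (fin_span_extend V w)
  have "(*) c ` {y + a * w | y a. y \<in> V \<and> a \<in> rat_closure v} =
      {y + a * (c * w) | y a. y \<in> (*) c ` V \<and> a \<in> rat_closure v}" (is "?A = ?B")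
  proof
    show "?A \<subseteq> ?B"
    proof clarify
      fix y a assume "y \<in> V" "a \<in> rat_closure v"
      then show "\<exists>z b. c * (y + a * w) = z + b * (c * w) \<and> z \<in> (*) c ` V \<and> b \<in> rat_closure v"
        by (intro exI[of _ "c * y"] exI[of _ a]) (auto simp: algebra_simps)
    qed
    show "?B \<subseteq> ?A"
    proof clarify
      fix a y assume "y \<in> V" "a \<in> rat_closure v"
      then show "c * y + a * (c * w) \<in> ?A"
        by (intro image_eqI[of _ _ "y + a * w"]) (auto simp: algebra_simps)
    qed
  qed
  then show ?case using fin_span.fin_span_extend[OF fin_span_extend.IH] by simp
qed

text \<open>This ring takes the place of a finite field extension: if 1 \<in> V it is contained in
  V, so it is a ring inside a complete set even when V is not closed under products.\<close>

definition multipliers :: "'a set \<Rightarrow> 'a set" where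
  "multipliers V = {x. \<forall>y\<in>V. x * y \<in> V}"

lemma subring_set_multipliers:
  assumes "subspace_set V"
  shows "subring_set (multipliers V)"
  unfolding subring_set_def multipliers_def
  by (auto simp: left_diff_distrib mult.assoc intro: subspace_set_diff[OF assms])

text \<open>W = V + \<alpha> V + ... + \<alpha>^(d-1) V, where \<alpha> satisfies an equation of
  degree d over Q_p. Multiplication by \<alpha> moves each summand to the next, and the equation
  rewrites \<alpha>^d; the multipliers of V act on each summand.\<close>

lemma fin_span_adjoin:
  assumes V: "fin_span V" "1 \<in> V"
  obtains W where "fin_span W" "1 \<in> W" "multipliers V \<subseteq> multipliers W" "\<alpha> \<in> multipliers W"
proof -
  note VS = fin_span_subspace_complete[OF V(1), THEN conjunct1]
  obtain g where g: "g \<noteq> 0" "\<And>i. coeff g i \<in> rat_closure v" "poly g \<alpha> = 0"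
    using algebraic by blast
  define d where "d = degree g"
  have d: "d > 0"
  proof (rule ccontr)
    assume "\<not> d > 0"
    then obtain c where "g = [:c:]" by (auto simp: d_def elim: degree_eq_zeroE)
    then show False using g by auto
  qed
  define W where "W m = {\<Sum>i<m. \<alpha> ^ i * y i | y. \<forall>i. y i \<in> V}" for m
  have W: "fin_span (W m)" for m
  proof (induction m)
    case 0
    have "\<exists>y. \<forall>i::nat. y i \<in> V" using V(2) by (intro exI[of _ "\<lambda>_. 1"]) simp
    then have "W 0 = {0}" by (auto simp: W_def)
    then show ?case by (simp add: fin_span_0)
  next
    case (Suc m)
    have "W (Suc m) = {x + y | x y. x \<in> W m \<and> y \<in> (*) (\<alpha> ^ m) ` V}" (is "_ = ?R")
    proof
      show "W (Suc m) \<subseteq> ?R" by (auto simp: W_def)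
      show "?R \<subseteq> W (Suc m)"
      proof clarify
        fix x y assume x: "x \<in> W m" and y: "y \<in> V"
        obtain z where z: "\<forall>i. z i \<in> V" "x = (\<Sum>i<m. \<alpha> ^ i * z i)"
          using x by (auto simp: W_def)
        have "x + \<alpha> ^ m * y = (\<Sum>i<Suc m. \<alpha> ^ i * (z(m := y)) i)" using z by simp
        moreover have "\<forall>i. (z(m := y)) i \<in> V" using z y by simp
        ultimately show "x + \<alpha> ^ m * y \<in> W (Suc m)" unfolding W_def by blast
      qed
    qed
    then show ?case using fin_span_plus[OF Suc fin_span_scale[OF V(1)]] by simp
  qed
  note WS = fin_span_subspace_complete[OF W, THEN conjunct1]
  have pow: "\<alpha> ^ i * y \<in> W d" if "i < d" "y \<in> V" for i y
  proof -
    have "\<forall>j. (if j = i then y else 0) \<in> V"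
      using that VS by (auto simp: subspace_set_def)
    then have "(\<Sum>j<d. \<alpha> ^ j * (if j = i then y else 0)) \<in> W d"
      unfolding W_def by (intro CollectI exI[of _ "\<lambda>j. if j = i then y else 0"]) simp
    then show ?thesis
      using that by (simp add: if_distrib cong: if_cong)
  qed
  have "poly g \<alpha> = (\<Sum>i<d. coeff g i * \<alpha> ^ i) + coeff g d * \<alpha> ^ d"
    by (simp add: poly_altdef d_def lessThan_Suc_atMost[symmetric])
  then have "coeff g d * \<alpha> ^ d = - (\<Sum>i<d. coeff g i * \<alpha> ^ i)"
    using g(3) by (simp add: eq_neg_iff_add_eq_0 add.commute)
  then have "inverse (coeff g d) * (coeff g d * \<alpha> ^ d) = - inverse (coeff g d) * (\<Sum>i<d. coeff g i * \<alpha> ^ i)"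
    by simp
  then have \<alpha>d: "\<alpha> ^ d = (\<Sum>i<d. (- inverse (coeff g d) * coeff g i) * \<alpha> ^ i)"
    using g(1) by (simp add: d_def sum_distrib_left mult.assoc[symmetric] sum_negf)
  have gQ: "- inverse (coeff g d) * coeff g i \<in> rat_closure v" for i
    using g(2) by (intro subring_set_mult subring_set_uminus subring_set_rat_closure rat_closure_inverse)
  have powd: "\<alpha> ^ d * y \<in> W d" if "y \<in> V" for y
  proof -
    have "\<alpha> ^ d * y = (\<Sum>i<d. \<alpha> ^ i * ((- inverse (coeff g d) * coeff g i) * y))"
      unfolding \<alpha>d sum_distrib_right by (simp add: mult_ac)
    also have "\<dots> \<in> W d"
    proof (intro subspace_set_sum WS pow)
      fix i
      show "(- inverse (coeff g d) * coeff g i) * y \<in> V"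
        using VS gQ[of i] that unfolding subspace_set_def by blast
    qed auto
    finally show ?thesis .
  qed
  have "\<alpha> \<in> multipliers (W d)"
    unfolding multipliers_def
  proof (intro CollectI ballI)
    fix x assume "x \<in> W d"
    then obtain y where y: "\<forall>i. y i \<in> V" "x = (\<Sum>i<d. \<alpha> ^ i * y i)" by (auto simp: W_def)
    then have "\<alpha> * x = (\<Sum>i<d. \<alpha> ^ Suc i * y i)"
      by (simp add: sum_distrib_left mult.assoc)
    also have "\<dots> \<in> W d"
    proof (intro subspace_set_sum WS)
      fix i assume "i \<in> {..<d}"
      then show "\<alpha> ^ Suc i * y i \<in> W d"
        using y pow[of "Suc i" "y i"] powd[of "y i"] by (cases "Suc i = d") auto
    qed
    finally show "\<alpha> * x \<in> W d" .
  qed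
  moreover have "multipliers V \<subseteq> multipliers (W d)"
  proof
    fix b assume b: "b \<in> multipliers V"
    show "b \<in> multipliers (W d)"
      unfolding multipliers_def
    proof (intro CollectI ballI)
      fix x assume "x \<in> W d"
      then obtain y where y: "\<forall>i. y i \<in> V" "x = (\<Sum>i<d. \<alpha> ^ i * y i)" by (auto simp: W_def)
      then have "b * x = (\<Sum>i<d. \<alpha> ^ i * (b * y i))"
        by (simp add: sum_distrib_left mult.left_commute)
      then show "b * x \<in> W d"
        using b y unfolding W_def multipliers_def
        by (intro CollectI exI[of _ "\<lambda>i. b * y i"]) auto
    qed
  qed
  moreover have "1 \<in> W d" using pow[of 0 1] d V(2) by simp
  ultimately show ?thesis using W that by blast
qed

lemma finite_subset_complete_ring:
  assumes "finite X"
  obtains V S where "complete_set V" "subring_set S" "S \<subseteq> V" "rat_closure v \<subseteq> S" "X \<subseteq> S"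
proof -
  have "\<exists>V. fin_span V \<and> 1 \<in> V \<and> X \<subseteq> multipliers V"
    using assms
  proof (induction X)
    case empty
    have "fin_span {y + a * 1 | y a. y \<in> {0} \<and> a \<in> rat_closure v}"
      by (intro fin_span_extend fin_span_0)
    moreover have "1 \<in> {y + a * 1 | y a. y \<in> {0} \<and> a \<in> rat_closure v}"
      using subring_set_1[OF subring_set_rat_closure] by auto
    ultimately show ?case by blast
  next
    case (insert \<alpha> X)
    then obtain V where V: "fin_span V" "1 \<in> V" "X \<subseteq> multipliers V" by blast
    obtain W where "fin_span W" "1 \<in> W" "multipliers V \<subseteq> multipliers W" "\<alpha> \<in> multipliers W"
      using fin_span_adjoin[OF V(1,2)] by blast
    then show ?case using V(3) by blast
  qed
  then obtain V where V: "fin_span V" "1 \<in> V" "X \<subseteq> multipliers V" by blast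
  note VS = fin_span_subspace_complete[OF V(1)]
  show ?thesis
  proof
    show "complete_set V" using VS by blast
    show "subring_set (multipliers V)" using VS subring_set_multipliers by blast
    show "multipliers V \<subseteq> V"
    proof
      fix x assume "x \<in> multipliers V"
      then have "x * 1 \<in> V" using V(2) unfolding multipliers_def by blast
      then show "x \<in> V" by simp
    qed
    show "rat_closure v \<subseteq> multipliers V"
      using VS unfolding multipliers_def subspace_set_def by blast
  qed (rule V(3))
qed

text \<open>Partial sums in an ultrametric field are Cauchy once the terms tend to 0, and here the
  terms are at most M (v x / r)^k. The set V supplies the limit.\<close>

lemma gauss_bounded_converges_at:
  assumes F: "gauss_bounded r M F" and x: "v x < r"
    and V: "complete_set V" "\<And>N. (\<Sum>k<N. fps_nth F k * x ^ k) \<in> V"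
  shows "converges_at v F x"
proof -
  have r: "r > 0" using x v_nonneg[of x] by simp
  have "(\<lambda>k. M * (v x / r) ^ k) \<longlonglongrightarrow> 0"
    using x r v_nonneg[of x] by (intro tendsto_mult_right_zero LIMSEQ_realpow_zero) auto
  have cauchy: "\<exists>N. \<forall>m\<ge>N. \<forall>n\<ge>N. v ((\<Sum>k<m. fps_nth F k * x ^ k) - (\<Sum>k<n. fps_nth F k * x ^ k)) < e"
    if e: "e > 0" for e
  proof -
    obtain N where N: "\<And>k. k \<ge> N \<Longrightarrow> M * (v x / r) ^ k < e / 2"
      using order_tendstoD(2)[OF \<open>(\<lambda>k. M * (v x / r) ^ k) \<longlonglongrightarrow> 0\<close>, of "e / 2"] e
      unfolding eventually_sequentially by auto
    have term_le: "v (fps_nth F k * x ^ k) \<le> e / 2" if "k \<ge> N" for k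
    proof -
      have "v (fps_nth F k * x ^ k) = (v (fps_nth F k) * r ^ k) * (v x / r) ^ k"
        using r by (simp add: v_mult v_power power_divide)
      also have "\<dots> \<le> M * (v x / r) ^ k"
        using F r v_nonneg[of x] unfolding gauss_bounded_def by (intro mult_right_mono) auto
      finally show ?thesis using N[OF that] by simp
    qed
    have le: "v ((\<Sum>k<m. fps_nth F k * x ^ k) - (\<Sum>k<n. fps_nth F k * x ^ k)) < e"
      if "n \<ge> N" "n \<le> m" for m n
    proof -
      have "(\<Sum>k<m. fps_nth F k * x ^ k) - (\<Sum>k<n. fps_nth F k * x ^ k) =
          (\<Sum>k=n..<m. fps_nth F k * x ^ k)"
        using sum_diff_nat_ivl[of 0 n m "\<lambda>k. fps_nth F k * x ^ k"] that
        by (simp add: lessThan_atLeast0)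
      also have "v \<dots> \<le> e / 2" using that e by (intro v_sum_le term_le) auto
      finally show ?thesis using e by simp
    qed
    show ?thesis
    proof (intro exI[of _ N] allI impI)
      fix m n assume "N \<le> m" "N \<le> n"
      then show "v ((\<Sum>k<m. fps_nth F k * x ^ k) - (\<Sum>k<n. fps_nth F k * x ^ k)) < e"
        using le[of n m] le[of m n] v_minus_commute by (cases "n \<le> m") auto
    qed
  qed
  show ?thesis
    using V(1)[unfolded complete_set_def, THEN spec, of "\<lambda>N. \<Sum>k<N. fps_nth F k * x ^ k"]
      V(2) cauchy unfolding converges_at_def by blast
qed

section \<open>The universal series\<close>

definition p_powers_fps :: "(nat \<Rightarrow> 'b::zero) \<Rightarrow> 'b fps" where
  "p_powers_fps c = Abs_fps (\<lambda>k. if \<exists>j. k = p ^ j then c (THE j. k = p ^ j) else 0)"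

lemma p_powers_fps_power: "fps_nth (p_powers_fps c) (p ^ j) = c j"
proof -
  have "(THE i. p ^ j = p ^ i) = j"
    using p_gt_1 by (intro the_equality) auto
  then show ?thesis by (auto simp: p_powers_fps_def)
qed

lemma p_powers_fps_1: "fps_nth (p_powers_fps c) (Suc 0) = c 0"
  using p_powers_fps_power[of c 0] by simp

lemma p_powers_fps_other: "(\<And>j. k \<noteq> p ^ j) \<Longrightarrow> fps_nth (p_powers_fps c) k = 0"
  by (auto simp: p_powers_fps_def)

section \<open>Size of the iterates in each power of T\<close>

definition unit_ball :: "'a set" where
  "unit_ball = {x. v x \<le> 1}"

lemma subring_set_unit_ball: "subring_set unit_ball"
  unfolding subring_set_def unit_ball_def
  by (auto simp: v_mult v_nonneg intro: v_diff_le mult_le_one)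

lemma padic_integers_subset_unit_ball: "padic_integers v \<subseteq> unit_ball"
  by (auto simp: padic_integers_def unit_ball_def)

lemma poly_iterate_in_unit_ball: "f \<in> poly_set unit_ball \<Longrightarrow> poly_iterate f j \<in> poly_set unit_ball"
proof (induction j)
  case 0
  show ?case
    by (auto simp: poly_set_def coeff_pCons unit_ball_def split: nat.splits)
qed (auto intro: pcompose_in_poly_set subring_set_unit_ball)

lemma coeff_0_poly_iterate: "coeff f 0 = 0 \<Longrightarrow> coeff (poly_iterate f j) 0 = 0"
  by (induction j) (auto simp: poly_0_coeff_0)

lemma v_coeff_mult_le:
  assumes "c \<ge> 0" "d \<ge> 0" "\<And>i. i \<le> m \<Longrightarrow> v (coeff q i) \<le> c" "\<And>i. i \<le> m \<Longrightarrow> v (coeff r i) \<le> d"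
  shows "v (coeff (q * r) m) \<le> c * d"
  unfolding coeff_mult
  using assms by (intro v_sum_le) (auto simp: v_mult v_nonneg intro!: mult_mono)

text \<open>As q has no constant term, the coefficients of q^2 up to degree M use only q_i with 0 <
  i < M. So bounds below degree M control degree M itself, which drives the induction on the
  degree.\<close>

lemma v_coeff_square_mult_le:
  assumes "coeff q 0 = 0" "c \<ge> 0" "\<And>i. i < M \<Longrightarrow> v (coeff q i) \<le> c" "r \<in> poly_set unit_ball" "m \<le> M"
  shows "v (coeff (q * (q * r)) m) \<le> c ^ 2"
proof -
  have "v (coeff (q * q) k) \<le> c ^ 2" if "k \<le> m" for k
    unfolding coeff_mult
  proof (intro v_sum_le)
    fix i assume i: "i \<in> {..k}"
    show "v (coeff q i * coeff q (k - i)) \<le> c ^ 2"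
    proof (cases "i = 0 \<or> i = k")
      case False
      then have "i < M" "k - i < M" using i that assms(5) by auto
      then show ?thesis
        using assms(2,3) by (auto simp: v_mult power2_eq_square v_nonneg intro!: mult_mono)
    qed (use assms in auto)
  qed simp
  then have "v (coeff ((q * q) * r) m) \<le> c ^ 2 * 1"
    using assms(4) by (intro v_coeff_mult_le) (auto simp: poly_set_def unit_ball_def)
  then show ?thesis by (simp add: mult.assoc)
qed

text \<open>Induction on the degree bound M. In F_(j+1) = u p F_j + F_j^2 g(F_j) the first term
  gains a factor 1/p, and the second is O(p^(-2j)) in degree M by the bounds in lower degrees. The
  constant depends on M.\<close>

lemma v_coeff_poly_iterate_le:
  assumes f: "f = pCons 0 (pCons (u * of_nat p) g)" and u: "v u \<le> 1" and g: "g \<in> poly_set unit_ball"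
    and fO: "f \<in> poly_set unit_ball"
  shows "\<exists>C\<ge>0. \<forall>m<M. \<forall>j. v (coeff (poly_iterate f j) m) \<le> C * (1 / real p) ^ j"
proof (induction M)
  case 0
  then show ?case by auto
next
  case (Suc M)
  define P where "P = poly_iterate f"
  obtain C where C: "C \<ge> 0" "\<And>m j. m < M \<Longrightarrow> v (coeff (P j) m) \<le> C * (1 / real p) ^ j"
    using Suc P_def by blast
  have P_Suc: "P (Suc j) = smult (u * of_nat p) (P j) + P j * (P j * pcompose g (P j))" for j
    by (simp add: P_def f pcompose_pCons algebra_simps)
  have PO: "P j \<in> poly_set unit_ball" for j
    unfolding P_def by (rule poly_iterate_in_unit_ball[OF fO])
  have P0: "coeff (P j) 0 = 0" for j
    unfolding P_def by (rule coeff_0_poly_iterate) (simp add: f)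
  \<comment> \<open>1 starts the induction at j = 0, C serves the degrees below M, and p C^2 absorbs
    the quadratic term, since C^2 p^(-2j) \<le> p C^2 p^(-(j+1)).\<close>
  define C' where "C' = max 1 (max C (real p * C ^ 2))"
  have C': "C' \<ge> 1" "C' \<ge> C" "real p * C ^ 2 \<le> C'" by (auto simp: C'_def)
  have "v (coeff (P j) M) \<le> C' * (1 / real p) ^ j" for j
  proof (induction j)
    case 0
    have "v (coeff (P 0) M) \<le> 1" using PO by (auto simp: poly_set_def unit_ball_def)
    then show ?case using C' by simp
  next
    case (Suc j)
    have "v (coeff (smult (u * of_nat p) (P j)) M) \<le> 1 * (1 / real p * (C' * (1 / real p) ^ j))"
      using u Suc C' by (simp only: coeff_smult v_mult v_p mult.assoc) (intro mult_mono, auto simp: v_nonneg)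
    moreover have "v (coeff (P j * (P j * pcompose g (P j))) M) \<le> (C * (1 / real p) ^ j) ^ 2"
      using C PO P0 g
      by (intro v_coeff_square_mult_le[where M = M] pcompose_in_poly_set subring_set_unit_ball) auto
    moreover have "(C * (1 / real p) ^ j) ^ 2 \<le> C' * (1 / real p) ^ Suc j"
    proof -
      have "(1 / real p) ^ (2 * j) \<le> (1 / real p) ^ j"
        using p_gt_1 by (intro power_decreasing) auto
      then have "(C * (1 / real p) ^ j) ^ 2 \<le> C ^ 2 * (1 / real p) ^ j"
        unfolding power_mult_distrib power_even_eq[symmetric] by (intro mult_left_mono) auto
      also have "\<dots> = (real p * C ^ 2) * (1 / real p) ^ Suc j"
        using p_gt_1 by simp
      also have "\<dots> \<le> C' * (1 / real p) ^ Suc j"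
        using C' by (intro mult_right_mono) auto
      finally show ?thesis .
    qed
    ultimately show ?case
      unfolding P_Suc coeff_add by (intro v_add_le) auto
  qed
  moreover have "v (coeff (P j) m) \<le> C' * (1 / real p) ^ j" if "m < M" for j m
    using C(2)[OF that, of j] C'(2) by (rule order_trans[OF _ mult_right_mono]) auto
  ultimately show ?case
    using C' unfolding P_def[symmetric] by (intro exI[of _ C']) (auto simp: less_Suc_eq)
qed

text \<open>Decay in X for each bound m on the T-degree. Nothing uniform in T is claimed, because
  the constants for the iterates depend on the degree.\<close>

definition coeffwise_null :: "'a poly fps \<Rightarrow> bool" where
  "coeffwise_null F \<longleftrightarrow> (\<forall>m. \<forall>e>0. \<exists>N. \<forall>k\<ge>N. \<forall>i\<le>m. v (coeff (fps_nth F k) i) \<le> e)"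

lemma coeffwise_null_bounded:
  assumes "coeffwise_null F"
  obtains B where "B > 0" "\<And>k i. i \<le> m \<Longrightarrow> v (coeff (fps_nth F k) i) \<le> B"
proof -
  obtain N where N: "\<And>k i. k \<ge> N \<Longrightarrow> i \<le> m \<Longrightarrow> v (coeff (fps_nth F k) i) \<le> 1"
    using assms unfolding coeffwise_null_def by (meson zero_less_one)
  define X where "X = (\<lambda>(k, i). v (coeff (fps_nth F k) i)) ` ({..<N} \<times> {..m})"
  have X: "finite X" by (simp add: X_def)
  show ?thesis
  proof
    show "Max (insert 1 X) > 0" using X by (intro less_le_trans[OF zero_less_one Max_ge]) auto
    fix k i assume i: "i \<le> m"
    show "v (coeff (fps_nth F k) i) \<le> Max (insert 1 X)"
    proof (cases "k < N")
      case True
      then have "v (coeff (fps_nth F k) i) \<in> X" using i by (auto simp: X_def)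
      then show ?thesis using X by (intro Max_ge) auto
    next
      case False
      then have "v (coeff (fps_nth F k) i) \<le> 1" using N i by simp
      also have "1 \<le> Max (insert 1 X)" using X by (intro Max_ge) auto
      finally show ?thesis .
    qed
  qed
qed

lemma coeffwise_null_1: "coeffwise_null 1"
  unfolding coeffwise_null_def by (auto intro!: exI[of _ 1])

text \<open>In the Cauchy product one of the indices l and k - l is large, so one factor is small
  while the other is bounded; T-degrees up to m involve only degrees up to m of both
  factors.\<close>

lemma coeffwise_null_mult:
  assumes A: "coeffwise_null A" and B: "coeffwise_null B"
  shows "coeffwise_null (A * B)"
  unfolding coeffwise_null_def
proof (intro allI impI)
  fix m and e :: real assume e: "e > 0"
  obtain a where a: "a > 0" "\<And>k i. i \<le> m \<Longrightarrow> v (coeff (fps_nth A k) i) \<le> a"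
    using coeffwise_null_bounded[OF A] by blast
  obtain b where b: "b > 0" "\<And>k i. i \<le> m \<Longrightarrow> v (coeff (fps_nth B k) i) \<le> b"
    using coeffwise_null_bounded[OF B] by blast
  have "e / b > 0" "e / a > 0" using e a b by auto
  then obtain N1 N2 where N1: "\<And>k i. k \<ge> N1 \<Longrightarrow> i \<le> m \<Longrightarrow> v (coeff (fps_nth A k) i) \<le> e / b"
    and N2: "\<And>k i. k \<ge> N2 \<Longrightarrow> i \<le> m \<Longrightarrow> v (coeff (fps_nth B k) i) \<le> e / a"
    using A B unfolding coeffwise_null_def by meson
  have "v (coeff (fps_nth (A * B) k) i) \<le> e" if k: "k \<ge> N1 + N2" and i: "i \<le> m" for k i
    unfolding fps_mult_nth coeff_sum
  proof (intro v_sum_le)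
    fix l assume l: "l \<in> {0..k}"
    show "v (coeff (fps_nth A l * fps_nth B (k - l)) i) \<le> e"
    proof (cases "l \<ge> N1")
      case True
      then have "v (coeff (fps_nth A l * fps_nth B (k - l)) i) \<le> e / b * b"
        using e a b i by (intro v_coeff_mult_le N1) auto
      then show ?thesis using b by simp
    next
      case False
      then have "k - l \<ge> N2" using k by simp
      then have "v (coeff (fps_nth A l * fps_nth B (k - l)) i) \<le> a * (e / a)"
        using e a b i by (intro v_coeff_mult_le N2) auto
      then show ?thesis using a by simp
    qed
  qed (use e in simp)
  then show "\<exists>N. \<forall>k\<ge>N. \<forall>i\<le>m. v (coeff (fps_nth (A * B) k) i) \<le> e" by blast
qed

lemma coeffwise_null_power: "coeffwise_null A \<Longrightarrow> coeffwise_null (A ^ n)"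
  by (induction n) (auto intro: coeffwise_null_1 coeffwise_null_mult)

lemma coeff_fps_power_eq_0:
  fixes G :: "'b::comm_ring_1 poly fps"
  assumes G0: "\<And>k. coeff (fps_nth G k) 0 = 0"
  shows "a < i \<Longrightarrow> coeff (fps_nth (G ^ i) k) a = 0"
proof (induction i arbitrary: a k)
  case (Suc i)
  have "coeff (fps_nth G l) b * coeff (fps_nth (G ^ i) (k - l)) (a - b) = 0" if "b \<le> a" for l b
    using Suc G0 that by (cases "b = 0") auto
  then show ?case by (simp add: fps_mult_nth coeff_sum coeff_mult)
qed simp

definition poly_exp_fps :: "'a poly fps" where
  "poly_exp_fps = Abs_fps (\<lambda>i. [:1 / fact i:])"

lemma is_exp_fps_poly_exp_fps: "is_exp_fps poly_exp_fps"
  unfolding is_exp_fps_def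
proof
  fix i
  have "(fact i :: 'a poly) = [:fact i:]"
    using of_nat_poly[of "fact i", where ?'a = 'a] by simp
  then show "fact i * fps_nth poly_exp_fps i = 1"
    by (simp add: poly_exp_fps_def one_pCons)
qed

text \<open>Only the powers \<open>G ^ i\<close> with \<open>i \<le> m\<close> contribute to the coefficient of \<open>T ^ m\<close>.\<close>

lemma coeffwise_null_exp_compose:
  assumes G: "coeffwise_null G" and G0: "\<And>k. coeff (fps_nth G k) 0 = 0"
  shows "coeffwise_null (poly_exp_fps oo G)"
  unfolding coeffwise_null_def
proof (intro allI impI)
  fix m and e :: real assume e: "e > 0"
  have vf: "v (fact i) > 0" for i
    using v_nonneg[of "fact i"] v_eq_0_iff[of "fact i"] by simp
  \<comment> \<open>The factor \<open>v (fact i)\<close> in the tolerance pays for the denominator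
    of exp. Only i \<le> m will matter, so the maximum of finitely many thresholds suffices.\<close>
  have "\<exists>N. \<forall>k\<ge>N. \<forall>a\<le>m. v (coeff (fps_nth (G ^ i) k) a) \<le> e * v (fact i)" for i
    using coeffwise_null_power[OF G, of i] e vf[of i] unfolding coeffwise_null_def by simp
  then obtain N where N: "\<And>i k a. k \<ge> N i \<Longrightarrow> a \<le> m \<Longrightarrow> v (coeff (fps_nth (G ^ i) k) a) \<le> e * v (fact i)"
    by metis
  have "v (coeff (fps_nth (poly_exp_fps oo G) k) a) \<le> e" if k: "k \<ge> Max (N ` {..m})" and a: "a \<le> m" for k a
    unfolding fps_compose_nth coeff_sum
  proof (intro v_sum_le)
    fix i
    have coeff_eq: "coeff (fps_nth poly_exp_fps i * fps_nth (G ^ i) k) a = coeff (fps_nth (G ^ i) k) a / fact i"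
      by (simp add: poly_exp_fps_def)
    show "v (coeff (fps_nth poly_exp_fps i * fps_nth (G ^ i) k) a) \<le> e"
    proof (cases "i \<le> m")
      case True
      then have "N i \<le> Max (N ` {..m})" by (intro Max_ge) auto
      then have "N i \<le> k" using k by (rule order_trans)
      then have "v (coeff (fps_nth (G ^ i) k) a) \<le> e * v (fact i)" using a by (rule N)
      then show ?thesis using vf[of i] by (simp add: coeff_eq v_divide field_simps)
    next
      case False
      then show ?thesis using coeff_fps_power_eq_0[of G a i k] G0 a e by (simp add: coeff_eq)
    qed
  qed (use e in simp)
  then show "\<exists>N. \<forall>k\<ge>N. \<forall>i\<le>m. v (coeff (fps_nth (poly_exp_fps oo G) k) i) \<le> e" by blast
qed

text \<open>The T-degree of coefficient k may grow with k, so high degrees are treated by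
  integrality: above degree m the terms are at most v(x)^m, and up to degree m the coefficients are
  small for large k.\<close>

lemma coeffwise_null_poly_eval:
  assumes F: "coeffwise_null F" and FO: "\<And>k. fps_nth F k \<in> poly_set unit_ball"
    and x: "v x < 1" and e: "e > 0"
  obtains N where "\<And>k. k \<ge> N \<Longrightarrow> v (poly (fps_nth F k) x) \<le> e"
proof -
  have "(\<lambda>m. v x ^ m) \<longlonglongrightarrow> 0" using x v_nonneg[of x] by (intro LIMSEQ_realpow_zero) auto
  from order_tendstoD(2)[OF this e] obtain m where m: "v x ^ m < e"
    unfolding eventually_sequentially by blast
  obtain N where N: "\<And>k i. k \<ge> N \<Longrightarrow> i \<le> m \<Longrightarrow> v (coeff (fps_nth F k) i) \<le> e"
    using F e unfolding coeffwise_null_def by meson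
  have "v (poly (fps_nth F k) x) \<le> e" if k: "k \<ge> N" for k
    unfolding poly_altdef
  proof (intro v_sum_le)
    fix i
    have c1: "v (coeff (fps_nth F k) i) \<le> 1"
      using FO[of k] by (auto simp: poly_set_def unit_ball_def)
    show "v (coeff (fps_nth F k) i * x ^ i) \<le> e"
    proof (cases "i \<le> m")
      case True
      have "v (coeff (fps_nth F k) i) * v x ^ i \<le> e * 1"
        using N[OF k True] x v_nonneg[of x] e by (intro mult_mono power_le_one) (auto simp: v_nonneg)
      then show ?thesis by (simp add: v_mult v_power)
    next
      case False
      have "v (coeff (fps_nth F k) i) * v x ^ i \<le> 1 * v x ^ m"
        using c1 x v_nonneg[of x] False by (intro mult_mono power_decreasing) (auto simp: v_nonneg)
      then show ?thesis using m by (simp add: v_mult v_power)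
    qed
  qed (use e in simp)
  then show ?thesis using that by blast
qed

section \<open>The universal exponent and its Frobenius relation\<close>

definition iterate_fps :: "'a poly \<Rightarrow> 'a poly fps" where
  "iterate_fps f = p_powers_fps (\<lambda>j. smult (1 / of_nat p ^ j) (poly_iterate f j))"

definition universal_exponent :: "'a \<Rightarrow> 'a poly \<Rightarrow> 'a poly fps" where
  "universal_exponent u f = iterate_fps f - fps_const [:u:] * (iterate_fps f oo fps_X ^ p)"

lemma universal_exponent_nth_1: "fps_nth (universal_exponent u f) 1 = [:0, 1:]"
  using p_gt_1
  by (simp add: p_powers_fps_1 universal_exponent_def iterate_fps_def fps_nth_compose_X_power)

text \<open>The shifted series u Q(X^p) meets the next iterate at the same exponent. For a
  Lubin-Tate f the iterate alone, divided by p^(j+1), would only stay bounded in each T-degree; the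
  difference tends to 0.\<close>

lemma universal_exponent_nth_power:
  "fps_nth (universal_exponent u f) (p ^ Suc j) =
     smult (1 / of_nat p ^ Suc j) (poly_iterate f (Suc j) - smult (u * of_nat p) (poly_iterate f j))"
proof -
  have p0: "(of_nat p :: 'a) \<noteq> 0" "p > 0" using p_gt_1 by auto
  have "p ^ Suc j div p = p ^ j" using p0 by simp
  then have "fps_nth (universal_exponent u f) (p ^ Suc j) =
      smult (1 / of_nat p ^ Suc j) (poly_iterate f (Suc j)) - smult (u * (1 / of_nat p ^ j)) (poly_iterate f j)"
    unfolding universal_exponent_def iterate_fps_def
    by (simp add: fps_nth_compose_X_power p_powers_fps_power del: power_Suc poly_iterate.simps)
  also have "u * (1 / of_nat p ^ j) = 1 / of_nat p ^ Suc j * (u * of_nat p)"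
    using p0 by simp
  finally show ?thesis by (simp add: smult_diff_right)
qed

lemma universal_exponent_nth_other:
  assumes "\<And>j. k \<noteq> p ^ j"
  shows "fps_nth (universal_exponent u f) k = 0"
proof -
  have "p dvd k \<Longrightarrow> k div p \<noteq> p ^ j" for j
    using assms[of "Suc j"] by auto
  then show ?thesis
    using assms p_gt_1 
    by (simp add: universal_exponent_def iterate_fps_def fps_nth_compose_X_power p_powers_fps_other)
qed

lemma universal_exponent_nth_cases [case_names one power other]:
  assumes "k = 1 \<Longrightarrow> thesis" "\<And>j. k = p ^ Suc j \<Longrightarrow> thesis" "(\<And>j. k \<noteq> p ^ j) \<Longrightarrow> thesis"
  shows thesis
  using assms by (metis not0_implies_Suc power_0)

lemma coeff_0_universal_exponent:
  assumes "coeff f 0 = 0"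
  shows "coeff (fps_nth (universal_exponent u f) k) 0 = 0"
proof (cases k rule: universal_exponent_nth_cases)
  case one
  then show ?thesis by (simp only: universal_exponent_nth_1) simp
next
  case (power j)
  then show ?thesis
    using assms by (simp only: universal_exponent_nth_power) (simp add: coeff_0_poly_iterate poly_0_coeff_0)
qed (simp add: universal_exponent_nth_other)

lemma coeffwise_null_universal_exponent:
  assumes f: "f = pCons 0 (pCons (u * of_nat p) g)" and u: "v u \<le> 1" and g: "g \<in> poly_set unit_ball"
    and fO: "f \<in> poly_set unit_ball"
  shows "coeffwise_null (universal_exponent u f)"
  unfolding coeffwise_null_def
proof (intro allI impI)
  fix m and e :: real assume e: "e > 0"
  define P where "P = poly_iterate f"
  obtain C where C: "C \<ge> 0" "\<And>i j. i < Suc m \<Longrightarrow> v (coeff (P j) i) \<le> C * (1 / real p) ^ j"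
    using v_coeff_poly_iterate_le[OF assms, of "Suc m"] unfolding P_def by blast
  have PO: "P j \<in> poly_set unit_ball" for j
    unfolding P_def by (rule poly_iterate_in_unit_ball[OF fO])
  have P0: "coeff (P j) 0 = 0" for j
    unfolding P_def by (rule coeff_0_poly_iterate) (simp add: f)
  \<comment> \<open>At k = p^(j+1) the denominator contributes p^(j+1) and the square C^2 p^(-2j),
    together p^2 C^2 / k; the 1 covers k = 1.\<close>
  define D where "D = max 1 (real p ^ 2 * C ^ 2)"
  have bound: "v (coeff (fps_nth (universal_exponent u f) k) i) \<le> D / real k"
    if k: "k > 0" and i: "i \<le> m" for k i
  proof (cases k rule: universal_exponent_nth_cases)
    case one
    have "v (coeff [:0, 1:] i) \<le> D"
      by (auto simp: D_def coeff_pCons split: nat.splits)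
    then show ?thesis by (simp only: one universal_exponent_nth_1 of_nat_1 div_by_1)
  next
    case (power j)
    have p0: "real p > 0" using p_gt_1 by simp
    have "P (Suc j) - smult (u * of_nat p) (P j) = P j * (P j * pcompose g (P j))"
      by (simp add: P_def f pcompose_pCons algebra_simps)
    then have "v (coeff (fps_nth (universal_exponent u f) k) i) =
        real p ^ Suc j * v (coeff (P j * (P j * pcompose g (P j))) i)"
      unfolding power universal_exponent_nth_power P_def[symmetric]
      by (simp add: v_divide v_power v_p power_one_over v_mult)
    also have "\<dots> \<le> real p ^ Suc j * (C * (1 / real p) ^ j) ^ 2"
      using C PO P0 g i
      by (intro mult_left_mono v_coeff_square_mult_le[where M = "Suc m"] pcompose_in_poly_set subring_set_unit_ball) auto
    also have "\<dots> = real p ^ 2 * C ^ 2 / real k"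
      using p0 by (simp add: power power2_eq_square power_one_over field_simps)
    also have "\<dots> \<le> D / real k"
      by (intro divide_right_mono) (auto simp: D_def)
    finally show ?thesis .
  next
    case other
    then show ?thesis by (simp add: universal_exponent_nth_other D_def)
  qed
  obtain N :: nat where N: "D / e < real N" using reals_Archimedean2 by blast
  have "D > 0" by (simp add: D_def)
  then have "real N > 0" using N e by (smt (verit) divide_pos_pos)
  have "v (coeff (fps_nth (universal_exponent u f) k) i) \<le> e" if "k \<ge> N" "i \<le> m" for k i
  proof -
    have k: "real k > 0" "real k \<ge> real N" using that \<open>real N > 0\<close> by auto
    then have "D / e < real k" using N by linarith
    then have "D / real k \<le> e" using k(1) e by (simp add: field_simps)
    then show ?thesis using bound[of k i] that k by simp
  qed
  then show "\<exists>N. \<forall>k\<ge>N. \<forall>i\<le>m. v (coeff (fps_nth (universal_exponent u f) k) i) \<le> e" by blast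
qed

lemma fps_X_power_p_nth_0: "fps_nth (fps_X ^ p :: 'b::comm_ring_1 fps) 0 = 0"
  using p_gt_1 by (simp add: fps_X_power_nth)

lemma universal_exponent_nth_0: "fps_nth (universal_exponent u f) 0 = 0"
  using p_gt_1 by (intro universal_exponent_nth_other) auto

text \<open>The substitution T \<mapsto> f(T) raises the index of the iterate and X \<mapsto> X^p
  raises the exponent to match, while the denominator p^j stays. The result is p Q without its term
  j = 0, which is p T X.\<close>

lemma frobenius_iterate_fps:
  "map_fps (\<lambda>q. pcompose q f) (iterate_fps f) oo fps_X ^ p =
     of_nat p * iterate_fps f - of_nat p * (fps_const [:0, 1:] * fps_X)"
proof (rule fps_ext)
  fix k
  have p0: "(of_nat p :: 'a) \<noteq> 0" "p > 0" using p_gt_1 by auto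
  have ofp: "fps_nth (of_nat p * H) i = of_nat p * fps_nth H i" for i and H :: "'a poly fps"
    by (metis fps_mult_left_const_nth fps_of_nat)
  have ofp': "of_nat p * q = smult (of_nat p) q" for q :: "'a poly"
    by (simp add: of_nat_poly)
  have lhs: "fps_nth (map_fps (\<lambda>q. pcompose q f) (iterate_fps f) oo fps_X ^ p) k =
      (if p dvd k then pcompose (fps_nth (iterate_fps f) (k div p)) f else 0)"
    by (simp add: fps_nth_compose_X_power)
  have rhs: "fps_nth (of_nat p * iterate_fps f - of_nat p * (fps_const [:0, 1:] * fps_X)) k =
      of_nat p * (fps_nth (iterate_fps f) k - [:0, 1:] * fps_nth fps_X k)"
    by (simp only: fps_sub_nth ofp fps_mult_left_const_nth right_diff_distrib)
  show "fps_nth (map_fps (\<lambda>q. pcompose q f) (iterate_fps f) oo fps_X ^ p) k =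
      fps_nth (of_nat p * iterate_fps f - of_nat p * (fps_const [:0, 1:] * fps_X)) k"
  proof (cases k rule: universal_exponent_nth_cases)
    case one
    then show ?thesis
      unfolding lhs rhs using p_gt_1 by (simp add: iterate_fps_def p_powers_fps_1)
  next
    case (power j)
    have "k div p = p ^ j" "p dvd k" "k \<noteq> 1" using p0 p_gt_1 power by auto
    then have "fps_nth (map_fps (\<lambda>q. pcompose q f) (iterate_fps f) oo fps_X ^ p) k =
        smult (1 / of_nat p ^ j) (poly_iterate f (Suc j))"
      unfolding lhs
      by (simp add: iterate_fps_def p_powers_fps_power pcompose_smult pcompose_poly_iterate
            del: poly_iterate.simps)
    also have "\<dots> = smult (of_nat p) (fps_nth (iterate_fps f) (p ^ Suc j))"
      unfolding iterate_fps_def p_powers_fps_power using p0 by simp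
    also have "\<dots> = of_nat p * (fps_nth (iterate_fps f) k - [:0, 1:] * fps_nth fps_X k)"
      using \<open>k \<noteq> 1\<close> unfolding ofp' power[symmetric] by simp
    finally show ?thesis unfolding rhs .
  next
    case other
    have "p dvd k \<Longrightarrow> k div p \<noteq> p ^ j" for j
      using other[of "Suc j"] by auto
    moreover have "k \<noteq> 1" using other[of 0] by simp
    ultimately show ?thesis
      unfolding lhs rhs using other by (simp add: iterate_fps_def p_powers_fps_other)
  qed
qed

text \<open>The substitution fixes the constant u, so the relation for Q can be used at X and again
  at X^p.\<close>

lemma frobenius_universal_exponent:
  "map_fps (\<lambda>q. pcompose q f) (universal_exponent u f) oo fps_X ^ p =
     of_nat p * universal_exponent u f +
     of_nat p * (fps_const [:u:] * (fps_const [:0, 1:] * fps_X ^ p) - fps_const [:0, 1:] * fps_X)"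
proof -
  define \<phi> where "\<phi> = (\<lambda>q. pcompose q f)"
  define Q where "Q = iterate_fps f"
  define R where "R = of_nat p * Q - of_nat p * (fps_const [:0, 1:] * fps_X)"
  have hom: "is_ring_hom \<phi>" unfolding \<phi>_def by (rule is_ring_hom_pcompose)
  have R: "map_fps \<phi> Q oo fps_X ^ p = R"
    unfolding \<phi>_def Q_def R_def by (rule frobenius_iterate_fps)
  have "map_fps \<phi> (universal_exponent u f) =
      map_fps \<phi> Q - fps_const [:u:] * (map_fps \<phi> Q oo fps_X ^ p)"
    unfolding universal_exponent_def Q_def[symmetric]
    by (simp add: map_fps_diff map_fps_mult map_fps_const map_fps_compose map_fps_X_power hom)
       (simp add: \<phi>_def)
  then have "map_fps \<phi> (universal_exponent u f) oo fps_X ^ p = R - fps_const [:u:] * (R oo fps_X ^ p)"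
    unfolding R
    by (simp add: fps_compose_sub_distrib fps_compose_mult_distrib[OF fps_X_power_p_nth_0] R)
  also have "R oo fps_X ^ p = of_nat p * (Q oo fps_X ^ p) - of_nat p * (fps_const [:0, 1:] * fps_X ^ p)"
  proof -
    have "of_nat p oo (fps_X ^ p :: 'a poly fps) = of_nat p"
      by (metis fps_const_compose fps_of_nat)
    then show ?thesis
      unfolding R_def
      by (simp add: fps_compose_sub_distrib fps_compose_mult_distrib[OF fps_X_power_p_nth_0]
          fps_X_fps_compose_startby0[OF fps_X_power_p_nth_0])
  qed
  finally show ?thesis
    unfolding \<phi>_def[symmetric] universal_exponent_def Q_def[symmetric] R_def
    by (simp add: algebra_simps)
qed

text \<open>The exponential turns the additive relation for G into the multiplicative hypothesis of
  Dwork's lemma, with exp(pW) = 1 + pV for W = u T X^p - T X. The congruence asked of \<phi> rests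
  on f \<equiv> T^p and on Fermat's congruence in Z_p.\<close>

lemma universal_exp_integral:
  assumes odd: "odd p" and u: "u \<in> padic_integers v"
    and f: "f \<in> poly_set (padic_integers v)"
    and frob: "cong_set (poly_set (padic_integers v)) (of_nat p) f (monom 1 p)"
  shows "poly_exp_fps oo universal_exponent u f \<in> fps_set (poly_set (padic_integers v))"
proof -
  define S where "S = poly_set (padic_integers v)"
  define G where "G = universal_exponent u f"
  define \<phi> where "\<phi> = (\<lambda>q. pcompose q f)"
  define W where "W = fps_const [:u:] * (fps_const [:0, 1:] * fps_X ^ p) - fps_const [:0, 1:] * fps_X"
  note Z = subring_set_padic_integers
  have S: "subring_set S" unfolding S_def by (rule subring_set_poly_set[OF Z])
  note E = is_exp_fps_poly_exp_fps
  have hom: "is_ring_hom \<phi>" unfolding \<phi>_def by (rule is_ring_hom_pcompose)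
  have const: "[:c:] \<in> S" if "c \<in> padic_integers v" for c
    using that subring_set_0[OF Z] by (auto simp: S_def poly_set_def coeff_pCons split: nat.splits)
  have T: "[:0, 1:] \<in> S"
    using subring_set_0[OF Z] subring_set_1[OF Z]
    by (auto simp: S_def poly_set_def coeff_pCons split: nat.splits)
  have fps_const: "fps_const c \<in> fps_set S" if "c \<in> S" for c
    using that subring_set_0[OF S] by (auto simp: fps_set_def)
  have X: "fps_X ^ n \<in> fps_set S" for n
    using subring_set_0[OF S] subring_set_1[OF S] by (auto simp: fps_set_def fps_X_power_nth)
  have W: "W \<in> fps_set S"
    unfolding W_def using X[of 1]
    by (intro subring_set_diff subring_set_mult subring_set_fps_set S fps_const const T X u) simp
  have W0: "fps_nth W 0 = 0" using p_gt_1 by (simp add: W_def fps_X_power_p_nth_0)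
  have G0: "fps_nth G 0 = 0" unfolding G_def by (rule universal_exponent_nth_0)
  define e where "e = Abs_fps (\<lambda>i. if i = 0 then 0 else [:of_nat p ^ (i - 1) / fact i:] :: 'a poly)"
  have e: "fps_nth e i \<in> S \<and> fact i * fps_nth e i = of_nat p ^ (i - 1)" if "i > 0" for i
  proof
    have "of_rat (of_nat p ^ (i - 1) / of_nat (fact i)) \<in> rat_closure v" by (rule rat_closure_of_rat)
    then have "of_nat p ^ (i - 1) / fact i \<in> rat_closure v" by (simp add: of_rat_divide of_rat_power of_rat_fact)
    then show "fps_nth e i \<in> S"
      using that v_prime_power_div_fact_le[OF odd that] by (auto simp: e_def padic_integers_def intro!: const)
    have "(fact i :: 'a poly) = [:fact i:]"
      using of_nat_poly[of "fact i", where ?'a = 'a] by simp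
    then show "fact i * fps_nth e i = of_nat p ^ (i - 1)"
      using that by (simp add: e_def of_nat_poly poly_const_pow)
  qed
  obtain V where V: "V \<in> fps_set S" "fps_nth V 0 = 0" "poly_exp_fps oo (of_nat p * W) = 1 + of_nat p * V"
    using exp_compose_prime_mult[OF S E e _ W] by (auto simp: e_def)
  have "fps_twist \<phi> p (poly_exp_fps oo G) = map_fps \<phi> (poly_exp_fps oo G) oo fps_X ^ p"
    using p_gt_1 by (intro fps_twist_conv_compose) auto
  also have "map_fps \<phi> (poly_exp_fps oo G) = poly_exp_fps oo map_fps \<phi> G"
    using is_exp_fps_unique[OF is_exp_fps_map[OF hom E] E] by (simp add: map_fps_compose[OF hom])
  also have "poly_exp_fps oo map_fps \<phi> G oo fps_X ^ p = poly_exp_fps oo (map_fps \<phi> G oo fps_X ^ p)"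
    using G0 by (intro fps_compose_assoc[symmetric] fps_X_power_p_nth_0) (simp add: is_ring_hom_simps[OF hom])
  also have "map_fps \<phi> G oo fps_X ^ p = of_nat p * G + of_nat p * W"
    unfolding \<phi>_def G_def W_def by (rule frobenius_universal_exponent)
  also have "poly_exp_fps oo \<dots> = (poly_exp_fps oo (of_nat p * G)) * (poly_exp_fps oo (of_nat p * W))"
    using G0 W0 by (intro exp_compose_add E) simp_all
  also have "\<dots> = (poly_exp_fps oo G) ^ p * (1 + of_nat p * V)"
    unfolding V(3) exp_compose_of_nat_mult[OF E G0] ..
  finally have eq: "fps_twist \<phi> p (poly_exp_fps oo G) = (poly_exp_fps oo G) ^ p * (1 + of_nat p * V)" .
  have "poly_exp_fps oo G \<in> fps_set S"
  proof (rule dwork_integrality[OF S prime_p _ _ _ V(1,2) eq])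
    show "\<phi> 0 = 0" using hom by (rule is_ring_hom_simps)
    show "fps_nth (poly_exp_fps oo G) 0 = 1" using is_exp_fps_0[OF E] by simp
    fix s assume "s \<in> S"
    then show "cong_set S (of_nat p) (\<phi> s) (s ^ p)"
      unfolding \<phi>_def S_def
      by (intro pcompose_frobenius Z prime_p padic_integers_fermat f frob)
  qed
  then show ?thesis by (simp add: G_def S_def)
qed

section \<open>Specialisation at T = \<omega> n\<close>

lemma v_poly_le_if_coeff_0:
  assumes "q \<in> poly_set unit_ball" "coeff q 0 = 0" "v x \<le> 1"
  shows "v (poly q x) \<le> v x"
  unfolding poly_altdef
proof (intro v_sum_le)
  fix i
  show "v (coeff q i * x ^ i) \<le> v x"
  proof (cases i)
    case (Suc j)
    have "v (coeff q i) * v x ^ i \<le> 1 * v x ^ 1"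
      using assms v_nonneg[of x] Suc
      by (intro mult_mono power_decreasing) (auto simp: v_nonneg poly_set_def unit_ball_def)
    then show ?thesis by (simp add: v_mult v_power)
  qed (use assms in \<open>simp add: v_nonneg\<close>)
qed (rule v_nonneg)

text \<open>The truncated subtraction is intended: once the chain reaches \<omega> 0 = 0 it stays
  there, because f has no constant term. Hence F_j vanishes at \<omega> n for all j \<ge> n.\<close>

lemma poly_iterate_coherent_roots:
  assumes \<omega>: "coherent_roots v f \<omega>" and f0: "coeff f 0 = 0"
  shows "poly (poly_iterate f j) (\<omega> n) = \<omega> (n - j)"
proof (induction j)
  case (Suc j)
  show ?case
  proof (cases "j < n")
    case True
    then have "poly f (\<omega> (n - j)) = \<omega> (n - j - 1)"
      using \<omega> unfolding coherent_roots_def by (metis Suc_leI One_nat_def zero_less_diff)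
    then show ?thesis using Suc by (simp add: poly_pcompose)
  next
    case False
    then show ?thesis using Suc \<omega> f0 by (simp add: poly_pcompose coherent_roots_def poly_0_coeff_0)
  qed
qed simp

definition E_exponent :: "'a \<Rightarrow> (nat \<Rightarrow> 'a) \<Rightarrow> nat \<Rightarrow> 'a fps" where
  "E_exponent u \<omega> n = (\<Sum>i<n. fps_const (\<omega> (n - i) / of_nat p ^ i) *
     (fps_X ^ (p ^ i) - fps_const u * fps_X ^ (p ^ (i + 1))))"

lemma E_series_eq: "E_series p u \<omega> n = fps_exp 1 oo E_exponent u \<omega> n"
  by (simp add: E_series_def E_exponent_def)

lemma universal_exponent_specialize:
  assumes \<omega>: "coherent_roots v f \<omega>" and f0: "coeff f 0 = 0"
  shows "map_fps (\<lambda>q. poly q (\<omega> n)) (universal_exponent u f) = E_exponent u \<omega> n"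
proof -
  define \<psi> where "\<psi> = (\<lambda>q. poly q (\<omega> n))"
  have hom: "is_ring_hom \<psi>" unfolding \<psi>_def by (rule is_ring_hom_poly)
  have Q: "map_fps \<psi> (iterate_fps f) = (\<Sum>i<n. fps_const (\<omega> (n - i) / of_nat p ^ i) * fps_X ^ (p ^ i))"
  proof (rule fps_ext)
    fix k
    have rhs: "fps_nth (\<Sum>i<n. fps_const (\<omega> (n - i) / of_nat p ^ i) * fps_X ^ (p ^ i)) k =
        (\<Sum>i<n. if k = p ^ i then \<omega> (n - i) / of_nat p ^ i else 0)"
      unfolding fps_sum_nth by (intro sum.cong) (auto simp: fps_X_power_nth)
    show "fps_nth (map_fps \<psi> (iterate_fps f)) k =
        fps_nth (\<Sum>i<n. fps_const (\<omega> (n - i) / of_nat p ^ i) * fps_X ^ (p ^ i)) k"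
    proof (cases "\<exists>j. k = p ^ j")
      case True
      then obtain j where j: "k = p ^ j" by blast
      have "(\<Sum>i<n. if k = p ^ i then \<omega> (n - i) / of_nat p ^ i else 0) =
          (\<Sum>i<n. if i = j then \<omega> (n - i) / of_nat p ^ i else 0)"
        using p_gt_1 by (intro sum.cong) (auto simp: j)
      \<comment> \<open>For j \<ge> n no index of the sum equals j, and the right side is 0 because
        \<omega> 0 = 0.\<close>
      also have "\<dots> = \<omega> (n - j) / of_nat p ^ j"
        using \<omega> by (auto simp: coherent_roots_def)
      finally show ?thesis
        unfolding rhs
        by (simp add: j \<psi>_def iterate_fps_def p_powers_fps_power poly_iterate_coherent_roots[OF \<omega> f0])
    next
      case False
      then show ?thesis
        unfolding rhs by (simp add: iterate_fps_def p_powers_fps_other is_ring_hom_simps[OF hom])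
    qed
  qed
  have "map_fps \<psi> (universal_exponent u f) =
      map_fps \<psi> (iterate_fps f) - fps_const u * (map_fps \<psi> (iterate_fps f) oo fps_X ^ p)"
    unfolding universal_exponent_def
    by (simp add: map_fps_diff map_fps_mult map_fps_const map_fps_compose map_fps_X_power hom)
       (simp add: \<psi>_def)
  also have "map_fps \<psi> (iterate_fps f) oo fps_X ^ p =
      (\<Sum>i<n. fps_const (\<omega> (n - i) / of_nat p ^ i) * fps_X ^ (p ^ (i + 1)))"
    unfolding Q fps_compose_sum_distrib fps_compose_mult_distrib[OF fps_X_power_p_nth_0]
    by (simp add: fps_X_power_compose[OF fps_X_power_p_nth_0] flip: power_mult)
  finally show ?thesis
    unfolding Q \<psi>_def[symmetric] E_exponent_def
    by (simp add: sum_distrib_left right_diff_distrib sum_subtractf mult.left_commute)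
qed

lemma E_exponent_nth_eq_0:
  assumes "k > p ^ n"
  shows "fps_nth (E_exponent u \<omega> n) k = 0"
  unfolding E_exponent_def fps_sum_nth
proof (intro sum.neutral ballI)
  fix i assume "i \<in> {..<n}"
  then have "p ^ i \<le> p ^ n" "p ^ (i + 1) \<le> p ^ n"
    using p_gt_1 by (auto intro!: power_increasing simp del: power_Suc)
  then show "fps_nth (fps_const (\<omega> (n - i) / of_nat p ^ i) *
      (fps_X ^ (p ^ i) - fps_const u * fps_X ^ (p ^ (i + 1)))) k = 0"
    using assms by (simp add: fps_X_power_nth del: power_Suc)
qed

lemma E_exponent_in_fps_set:
  assumes S: "subring_set S" "rat_closure v \<subseteq> S" and u: "u \<in> S" and \<omega>: "\<And>i. i \<le> n \<Longrightarrow> \<omega> i \<in> S"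
  shows "E_exponent u \<omega> n \<in> fps_set S"
  unfolding E_exponent_def
proof (intro subring_set_sum subring_set_mult subring_set_diff subring_set_fps_set S(1))
  fix i
  have X: "fps_X ^ m \<in> fps_set S" for m
    using subring_set_0[OF S(1)] subring_set_1[OF S(1)] by (auto simp: fps_set_def fps_X_power_nth)
  have const: "fps_const c \<in> fps_set S" if "c \<in> S" for c
    using that subring_set_0[OF S(1)] by (auto simp: fps_set_def)
  have "of_rat (1 / of_nat p ^ i) \<in> S" using S(2) rat_closure_of_rat by blast
  then have "\<omega> (n - i) * of_rat (1 / of_nat p ^ i) \<in> S"
    using \<omega> by (intro subring_set_mult S(1)) auto
  then show "fps_const (\<omega> (n - i) / of_nat p ^ i) \<in> fps_set S"
    by (intro const) (simp add: of_rat_divide of_rat_power)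
  show "fps_X ^ p ^ i \<in> fps_set S" "fps_X ^ p ^ (i + 1) \<in> fps_set S" by (rule X)+
  show "fps_const u \<in> fps_set S" using u by (rule const)
qed

lemma fps_exp_in_fps_set: "rat_closure v \<subseteq> S \<Longrightarrow> fps_exp 1 \<in> fps_set S"
proof -
  assume S: "rat_closure v \<subseteq> S"
  have "of_rat (1 / of_nat (fact i)) \<in> S" for i using S rat_closure_of_rat by blast
  then show ?thesis by (simp add: fps_set_def fps_exp_def of_rat_divide of_rat_fact)
qed

lemma over_convergent_E_series:
  assumes odd: "odd p" and u: "u \<in> padic_units v" and f: "lubin_tate_poly p v u f"
    and \<omega>: "coherent_roots v f \<omega>"
  shows "over_convergent v (E_series p u \<omega> n)"
proof -
  have uZ: "u \<in> padic_integers v" using u by (simp add: padic_units_def)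
  then have vu: "v u \<le> 1" by (simp add: padic_integers_def)
  have fZ: "f \<in> poly_set (padic_integers v)"
    and frob: "cong_set (poly_set (padic_integers v)) (of_nat p) f (monom 1 p)"
    using f by (auto simp: lubin_tate_poly_def padic_integer_polys_eq cong_set_def of_nat_poly)
  obtain g where g: "g \<in> poly_set (padic_integers v)" "f - monom (u * of_nat p) 1 = monom 1 2 * g"
    using f by (auto simp: lubin_tate_poly_def padic_integer_polys_eq)
  have f_eq: "f = pCons 0 (pCons (u * of_nat p) g)"
  proof -
    have "f = monom (u * of_nat p) 1 + monom 1 2 * g" using g(2) by (simp add: algebra_simps)
    also have "\<dots> = pCons 0 (pCons (u * of_nat p) g)"
      by (simp add: monom_Suc monom_0 numeral_2_eq_2)
    finally show ?thesis .
  qed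
  have f0: "coeff f 0 = 0" by (simp add: f_eq)
  have sub: "poly_set (padic_integers v) \<subseteq> poly_set unit_ball"
    using padic_integers_subset_unit_ball by (auto simp: poly_set_def)
  define G where "G = universal_exponent u f"
  define \<Theta> where "\<Theta> = poly_exp_fps oo G"
  have \<Theta>O: "fps_nth \<Theta> k \<in> poly_set unit_ball" for k
    using universal_exp_integral[OF odd uZ fZ frob] sub by (auto simp: \<Theta>_def G_def fps_set_def)
  have G_coeff_0: "coeff (fps_nth G k) 0 = 0" for k
    unfolding G_def using f0 by (rule coeff_0_universal_exponent)
  have null: "coeffwise_null \<Theta>"
    unfolding \<Theta>_def
    by (rule coeffwise_null_exp_compose[OF _ G_coeff_0])
       (use coeffwise_null_universal_exponent[OF f_eq vu] g fZ sub in \<open>auto simp: G_def\<close>)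
  have \<Theta>_coeff_0: "coeff (fps_nth \<Theta> k) 0 = 0" if "k > 0" for k
    unfolding \<Theta>_def fps_compose_nth coeff_sum
  proof (intro sum.neutral ballI)
    fix i
    show "coeff (fps_nth poly_exp_fps i * fps_nth (G ^ i) k) 0 = 0"
      using coeff_fps_power_eq_0[of G 0 i k] G_coeff_0 that
      by (cases "i = 0") (auto simp: coeff_mult)
  qed
  have v\<omega>: "v (\<omega> n) < 1" using \<omega> by (simp add: coherent_roots_def)

  have hom: "is_ring_hom (\<lambda>q. poly q (\<omega> n))" by (rule is_ring_hom_poly)
  have series: "map_fps (\<lambda>q. poly q (\<omega> n)) \<Theta> = fps_exp 1 oo E_exponent u \<omega> n"
    unfolding \<Theta>_def map_fps_compose[OF hom] G_def universal_exponent_specialize[OF \<omega> f0]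
    using is_exp_fps_unique[OF is_exp_fps_map[OF hom is_exp_fps_poly_exp_fps] is_exp_fps_fps_exp] by simp
  have "1 / real p > 0" using p_gt_1 by simp
  then obtain K where K: "\<And>k. k \<ge> K \<Longrightarrow> v (poly (fps_nth \<Theta> k) (\<omega> n)) \<le> 1 / real p"
    using coeffwise_null_poly_eval[OF null \<Theta>O v\<omega>] by blast
  \<comment> \<open>The bound \<rho> is v(\<omega> n): the coefficients of \<Theta> with k > 0 have
    no constant term in T. The degree bound for the exponent is p^n.\<close>
  obtain r where r: "r > 1" "gauss_bounded r 1 (map_fps (\<lambda>q. poly q (\<omega> n)) \<Theta>)"
  proof (rule exp_polynomial_gauss_bounded[OF odd _ _ series])
    show "fps_nth (E_exponent u \<omega> n) 0 = 0"
      using p_gt_1 by (simp add: E_exponent_def fps_sum_nth fps_X_power_nth)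
    show "fps_nth (E_exponent u \<omega> n) k = 0" if "k > p ^ n" for k
      using that by (rule E_exponent_nth_eq_0)
    show "v (fps_nth (map_fps (\<lambda>q. poly q (\<omega> n)) \<Theta>) k) \<le> v (\<omega> n)" if "k > 0" for k
      using v_poly_le_if_coeff_0[OF \<Theta>O \<Theta>_coeff_0[OF that]] v\<omega> by simp
  qed (use v\<omega> K in auto)
  have "converges_at v (E_series p u \<omega> n) x" if x: "v x < r" for x
  proof -
    \<comment> \<open>The point x, the unit u and the roots up to \<omega> n are adjoined together,
      so every partial sum at x lies in one complete set. That set depends on x; the radius r does
      not.\<close>
    have "finite (insert x (insert u (\<omega> ` {..n})))" by simp
    then obtain V S where VS: "complete_set V" "subring_set S" "S \<subseteq> V" "rat_closure v \<subseteq> S"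
        "insert x (insert u (\<omega> ` {..n})) \<subseteq> S"
      using finite_subset_complete_ring by metis
    have coeffs: "E_series p u \<omega> n \<in> fps_set S"
      unfolding E_series_eq using VS
      by (intro fps_compose_in_fps_set fps_exp_in_fps_set E_exponent_in_fps_set) auto
    have "(\<Sum>k<N. fps_nth (E_series p u \<omega> n) k * x ^ k) \<in> S" for N
      using coeffs VS by (intro subring_set_sum subring_set_mult subring_set_power) (auto simp: fps_set_def)
    then show ?thesis
      using r(2) x VS(1,3) unfolding series E_series_eq[symmetric]
      by (intro gauss_bounded_converges_at) auto
  qed
  then show ?thesis
    unfolding over_convergent_def using r(1) by (intro exI[of _ "r - 1"]) auto
qed

end

theorem theorem5p7:
  fixes p n :: nat
    and v :: "'a::{field_char_0, alg_closed_field} \<Rightarrow> real"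
    and u :: 'a and f :: "'a poly" and \<omega> :: "nat \<Rightarrow> 'a"
  assumes "prime p" and "odd p"
    and "padic_algebraic_closure p v"
    and "u \<in> padic_units v"
    and "lubin_tate_poly p v u f"
    and "coherent_roots v f \<omega>"
  shows "over_convergent v (E_series p u \<omega> n)"
proof -
  interpret padic_algebraic_closure p v by fact
  show ?thesis using assms by (intro over_convergent_E_series)
qed

end
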